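(* Let $L$ be a homogeneous differential operator of order $1$ with constant coefficients, i.e. $L(u)=T(\nabla u)$ for all $u\in C_c^\infty(\mathbb R^d,\mathbb R^m)$, where $T\colon M_{m,d}(\mathbb R)\to\mathbb R^k$ is linear. If there exists a non-zero matrix of rank at most $2$ in $\ker(T)$, then there is no constant $C$ such that for all $u\in C_c^\infty(\mathbb R^d,\mathbb R^m)$ $$\|\nabla u\|_{L^1(\mathbb R^d)}\le C\|Lu\|_{L^1(\mathbb R^d)}.$$ Moreover, the minimal constant $C_p$ such that the function $$f_p(A):=C_p^p\|T(A)\|^p-\|A\|^p,\qquad A\in M_{m,d}(\mathbb R),$$ is rank-one convex (which is finite if and only if $\ker(T)$ does not contain rank-one matrices) grows at least like $p^*-1$ as $p\to1$ or $p\to\infty$, where $p^*=\max\big(p,\frac{p}{p-1}\big)$.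
   Context: $M_{m,d}(\mathbb R)$ is the space of real $m\times d$ matrices with the Frobenius norm $\|A\|^2=\mathrm{Tr}(AA^t)$; $\mathbb R^k$ carries the Euclidean norm; $p$ ranges over $(1,\infty)$. A function $g\colon M_{m,d}(\mathbb R)\to\mathbb R$ is rank-one convex if it is convex on each segment joining two matrices $A,B$ with $\mathrm{rank}(A-B)=1$. The minimal constant $C_p$ is regarded as infinite if no finite constant makes $f_p$ rank-one convex. "Grows at least like $p^*-1$" means bounded below by a positive constant, independent of $p$, times $p^*-1$ in the stated limits.
   Formalization: The parenthetical equivalence (C_p finite iff ker(T) has no rank-one matrices) is proved for 1<p≤2; for p>2 only "finite implies no rank-one matrices" is stated, as the converse is false: C_p is infinite for every p>2 once ker(T) is non-zero. *)

theory Defs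
  imports "HOL-Analysis.Analysis"
begin

text \<open>
  A real \<open>m \<times> d\<close> matrix is an element of \<^typ>\<open>real^'d^'m\<close>. Its \<^const>\<open>norm\<close> is the
  Euclidean norm of the vector of Euclidean norms of the rows, which is the Frobenius norm.
\<close>

primrec Ck :: "nat \<Rightarrow> (real^'d \<Rightarrow> real^'m) \<Rightarrow> bool" where
  "Ck 0 u \<longleftrightarrow> continuous_on UNIV u"
| "Ck (Suc n) u \<longleftrightarrow> u differentiable_on UNIV \<and>
     (\<forall>i. Ck n (\<lambda>x. frechet_derivative u (at x) (axis i 1)))"

definition test_function :: "(real^'d \<Rightarrow> real^'m) \<Rightarrow> bool" where
  "test_function u \<longleftrightarrow> (\<forall>n. Ck n u) \<and> compact (closure {x. u x \<noteq> 0})"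

definition grad :: "(real^'d \<Rightarrow> real^'m) \<Rightarrow> real^'d \<Rightarrow> real^'d^'m" where
  "grad u x = jacobian u (at x)"

definition diff_op :: "(real^'d^'m \<Rightarrow> real^'k) \<Rightarrow> (real^'d \<Rightarrow> real^'m) \<Rightarrow> real^'d \<Rightarrow> real^'k" where
  "diff_op T u x = T (grad u x)"

definition L1_norm :: "(real^'d \<Rightarrow> 'b::real_normed_vector) \<Rightarrow> real" where
  "L1_norm g = (LINT x|lborel. norm (g x))"

definition rank_one_convex :: "(real^'d^'m \<Rightarrow> real) \<Rightarrow> bool" where
  "rank_one_convex g \<longleftrightarrow> (\<forall>A B. rank (A - B) = 1 \<longrightarrow> convex_on (closed_segment A B) g)"

definition f_p :: "(real^'d^'m \<Rightarrow> real^'k) \<Rightarrow> real \<Rightarrow> real \<Rightarrow> real^'d^'m \<Rightarrow> real" where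
  "f_p T p C A = C powr p * norm (T A) powr p - norm A powr p"

text \<open>
  For linear \<open>T\<close> and \<open>p > 1\<close> the set of admissible constants is closed and upward closed, so
  the infimum is a minimum when the set is nonempty, and it is \<open>\<infinity>\<close> otherwise. For \<open>p > 2\<close> no
  constant is admissible once \<open>T A = 0\<close> for some \<open>A \<noteq> 0\<close>: on the line \<open>A + t *\<^sub>R X\<close> with \<open>X\<close>
  of rank one, the second derivative at \<open>t = 0\<close> is \<open>0\<close> for \<open>norm (T (A + t *\<^sub>R X)) powr p\<close> and
  positive for \<open>norm (A + t *\<^sub>R X) powr p\<close>. Hence absence of rank-one matrices from the kernel
  does not make \<open>C_min T p\<close> finite for \<open>p > 2\<close>.
\<close>

definition C_min :: "(real^'d^'m \<Rightarrow> real^'k) \<Rightarrow> real \<Rightarrow> ereal" where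
  "C_min T p = Inf {ereal C |C. C \<ge> 0 \<and> rank_one_convex (f_p T p C)}"

definition pstar :: "real \<Rightarrow> real" where
  "pstar p = max p (p / (p - 1))"

end

theory Submission
  imports Defs
begin

text \<open>
  Write a nonzero kernel matrix of rank at most two as \<open>A = X + Y\<close> with \<open>X\<close> and \<open>Y\<close> of rank at most one.
  Then \<open>T Y = - T X\<close>, so on the matrices \<open>s X + t Y\<close> the map \<open>T\<close> only sees the difference \<open>s - t\<close>, while
  the norm also sees \<open>s + t\<close>. Moves along \<open>X\<close> and \<open>Y\<close> are the ones available both to gradients and to rank-one convexity.
  Alternating them keeps the difference small in mean and lets the sum grow.

  For the failure of the \<open>L\<^sup>1\<close> estimate this alternation is realized by Riesz products. If \<open>c k\<close> is a rapidly oscillating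
  cosine and \<open>P k = (\<Prod>j<k. 1 + c j)\<close>, then the sum of all increments \<open>c k * P k\<close> telescopes to \<open>P n - 1\<close>, whose mean absolute value
  is at most 2, whereas the sum over even \<open>k\<close> alone has mean absolute value at least of order \<open>sqrt n\<close>
  (\<open>sum_phases_even_part\<close>). A test map whose gradient is close to the even increments times \<open>X\<close>
  minus the odd increments times \<open>Y\<close> exists by \<open>oscillating_maps\<close>: the primitive of a fast wave is small, so cut-offs and
  earlier waves disturb the gradient only slightly. Independence of the waves is made exact by averaging over phases.

  The constant \<open>C_min\<close> is finite for \<open>1 < p \<le> 2\<close> without rank-one matrices in the kernel because the second derivatives
  of \<open>norm (T B) powr p\<close> and \<open>norm B powr p\<close> along rank-one lines are then comparable (\<open>convex_on_regularized\<close>). A rank-one matrix in the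
  kernel excludes every constant, and for \<open>p > 2\<close> any nonzero kernel matrix does
  (\<open>C_min_infinite_p_gt_2\<close>), which settles the limit at infinity. Near \<open>p = 1\<close> two rank-one segments in the span of
  \<open>X\<close> and \<open>Y\<close> suffice (\<open>rank_one_convex_imp_constant_bound\<close>): they bound a positive quantity by the \<open>p\<close>-th power of the constant times a factor
  of order \<open>p - 1\<close>.
\<close>

section \<open>Rank-one matrices\<close>

definition outer :: "real^'m \<Rightarrow> real^'d \<Rightarrow> real^'d^'m" where
  "outer a b = (\<chi> i j. a $ i * b $ j)"

lemma outer_component [simp]: "outer a b $ i $ j = a $ i * b $ j"
  by (simp add: outer_def)

lemma bilinear_outer: "bilinear outer"
  by (auto simp: bilinear_def linear_iff vec_eq_iff algebra_simps)

lemma outer_simps: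
  "outer (r *\<^sub>R a) b = r *\<^sub>R outer a b" "outer a (r *\<^sub>R b) = r *\<^sub>R outer a b"
  "outer (- a) b = - outer a b"
  "outer a (b + b') = outer a b + outer a b'" "outer a 0 = 0" "outer 0 b = 0"
  by (auto simp: vec_eq_iff algebra_simps)

lemma norm_outer: "norm (outer a b) = norm a * norm b"
proof (rule power2_eq_imp_eq)
  show "(norm (outer a b))\<^sup>2 = (norm a * norm b)\<^sup>2"
    unfolding power_mult_distrib power2_norm_eq_inner
    by (simp add: inner_vec_def sum_product sum_distrib_left mult_ac)
qed auto

lemma rank_outer:
  assumes "a \<noteq> 0" "b \<noteq> 0"
  shows "rank (outer a b) = 1"
proof -
  have "outer a b *v x = (b \<bullet> x) *\<^sub>R a" for x
    by (simp add: vec_eq_iff matrix_vector_mult_def inner_vec_def sum_distrib_left mult_ac)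
  then have "range ((*v) (outer a b)) = range (\<lambda>x. (b \<bullet> x) *\<^sub>R a)"
    by simp
  also have "\<dots> = span {a}"
  proof -
    have "r *\<^sub>R a \<in> range (\<lambda>x. (b \<bullet> x) *\<^sub>R a)" for r
      using assms by (intro image_eqI[where x = "(r / (b \<bullet> b)) *\<^sub>R b"]) auto
    then show ?thesis by (auto simp: span_singleton)
  qed
  finally show ?thesis
    using assms by (simp add: rank_dim_range)
qed

lemma rank_scaleR: "r \<noteq> 0 \<Longrightarrow> rank (r *\<^sub>R A) = rank (A :: real^'d^'m)"
proof -
  assume "r \<noteq> 0"
  have "range ((*v) (r *\<^sub>R A)) = (*\<^sub>R) r ` range ((*v) A)"
    by (simp add: image_image scaleR_matrix_vector_assoc)
  then show ?thesis
    using \<open>r \<noteq> 0\<close> by (simp add: rank_dim_range dim_image_eq inj_on_def)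
qed

text \<open>
  Taking a basis of the column space as \<open>B\<close> turns the rank into a count of the vectors that generate all columns.
\<close>

lemma column_basis:
  fixes A :: "real^'d^'m"
  obtains B where "card B = rank A" "finite B" "\<And>j. column j A \<in> span B"
proof -
  obtain B where B: "B \<subseteq> columns A" "independent B" "columns A \<subseteq> span B" "card B = dim (columns A)"
    using basis_exists by blast
  have "finite B" using B(2) independent_imp_finite by auto
  moreover have "column j A \<in> span B" for j
    using B(3) by (auto simp: columns_def)
  ultimately show ?thesis
    using that B(4) by (simp add: column_rank_def)
qed

lemma rank_one_imp_outer:
  fixes A :: "real^'d^'m"
  assumes "rank A = 1"
  obtains a b where "A = outer a b" "a \<noteq> 0" "b \<noteq> 0"
proof -
  obtain B where B: "card B = rank A" "finite B" "\<And>j. column j A \<in> span B"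
    using column_basis by blast
  obtain a where "B = {a}" using B(1) assms card_1_singletonE by auto
  then have "\<forall>j. \<exists>r. column j A = r *\<^sub>R a" using B(3) by (auto simp: span_singleton)
  then obtain r where r: "\<And>j. column j A = r j *\<^sub>R a" by metis
  have "A = outer a (\<chi> j. r j)"
    using r by (simp add: vec_eq_iff column_def mult.commute)
  moreover have "A \<noteq> 0" using assms by auto
  ultimately show ?thesis using that by (metis outer_simps(5,6))
qed

lemma rank_le_2_imp_sum_outer:
  fixes A :: "real^'d^'m"
  assumes "rank A \<le> 2"
  obtains a b c d where "A = outer a b + outer c d"
proof -
  obtain B where B: "card B = rank A" "finite B" "\<And>j. column j A \<in> span B"
    using column_basis by blast
  obtain a c where ac: "B \<subseteq> {a, c}"
  proof -
    consider "card B = 0" | "card B = 1" | "card B = 2" using B(1) assms by linarith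
    then show ?thesis
    proof cases
      case 1 then show ?thesis using that B(2) by auto
    next
      case 2 then show ?thesis using that by (metis card_1_singletonE insert_absorb2 subset_refl)
    next
      case 3 then show ?thesis using that by (metis card_2_iff subset_refl)
    qed
  qed
  have "\<exists>r s. column j A = r *\<^sub>R a + s *\<^sub>R c" for j
  proof -
    have "column j A \<in> span {a, c}" using B(3) span_mono[OF ac] by blast
    then obtain r where "column j A - r *\<^sub>R a \<in> span {c}" by (auto simp: span_insert)
    then obtain s where "column j A - r *\<^sub>R a = s *\<^sub>R c" by (auto simp: span_singleton)
    then show ?thesis by (metis add.commute diff_add_cancel)
  qed
  then obtain r s where rs: "\<And>j. column j A = r j *\<^sub>R a + s j *\<^sub>R c" by metis
  have "A = outer a (\<chi> j. r j) + outer c (\<chi> j. s j)"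
    using rs by (simp add: vec_eq_iff column_def mult.commute)
  then show ?thesis using that by blast
qed

text \<open>
  A rank-one matrix \<open>A\<close> is also covered, because \<open>A = 2 A + (- A)\<close>. This spares a separate treatment of
  rank one in the lower bound for the constants.
\<close>

lemma rank_le_2_split:
  fixes A :: "real^'d^'m"
  assumes "A \<noteq> 0" "rank A \<le> 2"
  obtains a b c d where "A = outer a b + outer c d" "a \<noteq> 0" "b \<noteq> 0" "c \<noteq> 0" "d \<noteq> 0"
proof -
  note result = that
  have one: thesis if "A = outer a b" for a b
  proof (rule result[of "2 *\<^sub>R a" b "- a" b])
    show "A = outer (2 *\<^sub>R a) b + outer (- a) b"
      using \<open>A = outer a b\<close> by (simp add: vec_eq_iff)
  qed (use \<open>A \<noteq> 0\<close> \<open>A = outer a b\<close> in \<open>auto simp: outer_simps\<close>)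
  obtain a b c d where A: "A = outer a b + outer c d"
    using rank_le_2_imp_sum_outer assms(2) by blast
  show thesis
  proof (cases "a = 0 \<or> b = 0 \<or> c = 0 \<or> d = 0")
    case True
    then show thesis using one[of a b] one[of c d] A by (auto simp: outer_simps)
  next
    case False
    then show thesis using result A by blast
  qed
qed

text \<open>
  Rank-one matrices of norm one form a compact set, the image of a product of two spheres under
  \<^const>\<open>outer\<close>, so \<open>norm (T X)\<close> attains a positive minimum on it. Homogeneity does the rest.
\<close>

lemma norm_lower_bound_rank_one:
  fixes T :: "real^'d^'m \<Rightarrow> real^'k"
  assumes T: "linear T" and ker: "\<not> (\<exists>A. rank A = 1 \<and> T A = 0)"
  obtains \<kappa> where "\<kappa> > 0" "\<And>X. rank X = 1 \<Longrightarrow> \<kappa> * norm X \<le> norm (T X)"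
proof -
  let ?K = "sphere 0 1 \<times> sphere 0 1 :: ((real^'m) \<times> (real^'d)) set"
  let ?g = "\<lambda>(a, b). norm (T (outer a b))"
  have bl: "bounded_linear T" using T linear_conv_bounded_linear by blast
  have bo: "bounded_bilinear (outer :: real^'m \<Rightarrow> real^'d \<Rightarrow> real^'d^'m)"
    using bilinear_outer bilinear_conv_bounded_bilinear by blast
  have "continuous_on ?K ?g"
    unfolding case_prod_unfold
    by (intro continuous_intros bounded_linear.continuous_on[OF bl]
        bounded_bilinear.continuous_on[OF bo])
  moreover have "compact ?K" by (intro compact_Times compact_sphere)
  moreover have "?K \<noteq> {}"
    using vector_choose_size[of 1] by (metis SigmaI empty_iff mem_sphere_0 zero_le_one)
  ultimately obtain z where z: "z \<in> ?K" "\<And>y. y \<in> ?K \<Longrightarrow> ?g z \<le> ?g y"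
    using continuous_attains_inf by meson
  obtain a0 b0 where z0: "z = (a0, b0)" by (cases z)
  have "a0 \<noteq> 0" "b0 \<noteq> 0" using z(1) z0 by auto
  then have "?g z > 0" using ker rank_outer[of a0 b0] z0 by auto
  moreover
  have "?g z * norm X \<le> norm (T X)" if X: "rank X = 1" for X
  proof -
    obtain a b where ab: "X = outer a b" "a \<noteq> 0" "b \<noteq> 0" using rank_one_imp_outer X by blast
    define a' where "a' = (1 / norm a) *\<^sub>R a"
    define b' where "b' = (1 / norm b) *\<^sub>R b"
    have X': "X = (norm a * norm b) *\<^sub>R outer a' b'"
      using ab by (simp add: a'_def b'_def outer_simps)
    have "?g z \<le> norm (T (outer a' b'))"
      using z(2)[of "(a', b')"] ab by (simp add: a'_def b'_def)
    then have "norm a * norm b * ?g z \<le> norm a * norm b * norm (T (outer a' b'))"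
      by (intro mult_left_mono) auto
    also have "\<dots> = norm (T X)"
      unfolding X' by (simp add: linear_cmul[OF T] abs_mult)
    finally show ?thesis
      by (simp add: ab(1) norm_outer mult.commute)
  qed
  ultimately show ?thesis using that by blast
qed

section \<open>Finiteness of the constant for exponents up to 2\<close>

lemma norm_powr: "(v \<bullet> v) powr (p / 2) = norm (v :: 'a::real_inner) powr p"
  using powr_powr[of "norm v" 2 "p / 2"] by (simp add: dot_square_norm)

text \<open>
  The function \<open>norm (v + t *\<^sub>R w) powr p\<close> need not be twice differentiable where \<open>v + t *\<^sub>R w\<close> vanishes.
  Adding \<open>\<epsilon>\<close> under the power removes this singularity.
\<close>

lemma regularized_norm_powr_derivatives:
  fixes v w :: "'a::real_inner"
  assumes "\<epsilon> > 0"
  defines "q \<equiv> \<lambda>t::real. \<epsilon> + (v + t *\<^sub>R w) \<bullet> (v + t *\<^sub>R w)"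
    and "l \<equiv> \<lambda>t::real. (v + t *\<^sub>R w) \<bullet> w"
  shows "((\<lambda>t. q t powr (p/2)) has_real_derivative p * l t * q t powr (p/2 - 1)) (at t)"
    and "((\<lambda>t. p * l t * q t powr (p/2 - 1)) has_real_derivative
      p * q t powr (p/2 - 2) * (q t * (w \<bullet> w) + (p - 2) * (l t)\<^sup>2)) (at t)"
proof -
  have pos: "q t > 0" for t
    using assms by (simp add: q_def add_pos_nonneg)
  have q: "(q has_real_derivative 2 * l t) (at t)" for t
    unfolding q_def l_def
    by (auto intro!: derivative_eq_intros simp: has_real_derivative_iff_has_vector_derivative[symmetric]
        has_field_derivative_def inner_commute algebra_simps inner_simps)
  have l: "(l has_real_derivative w \<bullet> w) (at t)" for t
    unfolding l_def
    by (auto intro!: derivative_eq_intros simp: has_field_derivative_def inner_commute algebra_simps inner_simps)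
  show "((\<lambda>t. q t powr (p/2)) has_real_derivative p * l t * q t powr (p/2 - 1)) (at t)"
    using pos[of t] by (auto intro!: derivative_eq_intros q simp: powr_diff field_simps)
  have e: "q t powr (p/2 - 1) = q t powr (p/2 - 2) * q t"
    using pos[of t] powr_add[of "q t" "p/2 - 2" 1] by simp
  have e': "q t powr (p/2 - 1 - 1) = q t powr (p/2 - 2)" by simp
  have "((\<lambda>t. q t powr (p/2 - 1)) has_real_derivative (p/2 - 1) * (2 * l t) * q t powr (p/2 - 2)) (at t)"
    using pos[of t] by (auto intro!: derivative_eq_intros q simp: powr_diff field_simps)
  from DERIV_mult[OF DERIV_cmult[OF l, of p] this]
  show "((\<lambda>t. p * l t * q t powr (p/2 - 1)) has_real_derivative
      p * q t powr (p/2 - 2) * (q t * (w \<bullet> w) + (p - 2) * (l t)\<^sup>2)) (at t)"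
    by (rule DERIV_cong) (simp add: e algebra_simps power2_eq_square)
qed

text \<open>
  By the Cauchy-Schwarz inequality the second derivative of \<open>(\<epsilon> + norm (v + t *\<^sub>R w)\<^sup>2) powr (p/2)\<close>
  lies between \<open>p - 1\<close> and \<open>1\<close> times \<open>p * (\<epsilon> + norm (v + t *\<^sub>R w)\<^sup>2) powr (p/2 - 1) * norm w\<^sup>2\<close>,
  for \<open>1 < p \<le> 2\<close>. As \<open>p/2 - 1 \<le> 0\<close>, the power does not increase with its base, so the upper bound
  on \<open>norm (T B)\<close> makes the term with \<open>T\<close> larger. The regularizations \<open>K\<^sup>2 * \<epsilon>\<close> and \<open>\<epsilon>\<close> are matched so that this
  comparison of bases survives.
\<close>

lemma convex_on_regularized:
  fixes T :: "'a::real_inner \<Rightarrow> 'b::real_inner"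
  assumes T: "linear T" and p: "1 < p" "p \<le> 2" and "\<epsilon> > 0"
    and K: "K > 0" "\<And>B. norm (T B) \<le> K * norm B"
    and \<kappa>: "\<kappa> > 0" "\<kappa> * norm X \<le> norm (T X)"
    and M: "M \<ge> 0" "M * ((p - 1) * K powr (p - 2) * \<kappa>\<^sup>2) \<ge> 1"
  shows "convex_on UNIV (\<lambda>t. M * (K\<^sup>2 * \<epsilon> + (T B + t *\<^sub>R T X) \<bullet> (T B + t *\<^sub>R T X)) powr (p/2)
    - (\<epsilon> + (B + t *\<^sub>R X) \<bullet> (B + t *\<^sub>R X)) powr (p/2))"
proof -
  define q Q l L where "q t = \<epsilon> + (B + t *\<^sub>R X) \<bullet> (B + t *\<^sub>R X)"
    and "Q t = K\<^sup>2 * \<epsilon> + (T B + t *\<^sub>R T X) \<bullet> (T B + t *\<^sub>R T X)"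
    and "l t = (B + t *\<^sub>R X) \<bullet> X" and "L t = (T B + t *\<^sub>R T X) \<bullet> T X" for t :: real
  have \<epsilon>': "K\<^sup>2 * \<epsilon> > 0" using K \<open>\<epsilon> > 0\<close> by simp
  note d = regularized_norm_powr_derivatives[where v = B and w = X and p = p, OF \<open>\<epsilon> > 0\<close>, folded q_def l_def]
  note D = regularized_norm_powr_derivatives[where v = "T B" and w = "T X" and p = p, OF \<epsilon>', folded Q_def L_def]
  have "p * q t powr (p/2 - 2) * (q t * (X \<bullet> X) + (p - 2) * (l t)\<^sup>2)
    \<le> M * (p * Q t powr (p/2 - 2) * (Q t * (T X \<bullet> T X) + (p - 2) * (L t)\<^sup>2))" for t
  proof -
    have pos: "q t > 0" "Q t > 0"
      using \<open>\<epsilon> > 0\<close> \<epsilon>' by (simp_all add: q_def Q_def add_pos_nonneg)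
    have qe: "q t powr (p/2 - 2) * q t = q t powr (p/2 - 1)"
      using pos powr_add[of "q t" "p/2 - 2" 1] by simp
    have Qe: "Q t powr (p/2 - 2) * Q t = Q t powr (p/2 - 1)"
      using pos powr_add[of "Q t" "p/2 - 2" 1] by simp
    have QX: "Q t \<le> K\<^sup>2 * q t"
    proof -
      have "(norm (T (B + t *\<^sub>R X)))\<^sup>2 \<le> (K * norm (B + t *\<^sub>R X))\<^sup>2"
        using K(2) by (intro power_mono) auto
      moreover have "T (B + t *\<^sub>R X) = T B + t *\<^sub>R T X"
        using T by (simp add: linear_add linear_cmul)
      ultimately show ?thesis
        by (simp add: q_def Q_def power_mult_distrib power2_norm_eq_inner algebra_simps)
    qed
    have X2: "\<kappa>\<^sup>2 * (X \<bullet> X) \<le> T X \<bullet> T X"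
      using power_mono[OF \<kappa>(2), of 2] \<kappa>(1) by (simp add: power_mult_distrib power2_norm_eq_inner)
    have CS: "(L t)\<^sup>2 \<le> Q t * (T X \<bullet> T X)"
    proof -
      have "(L t)\<^sup>2 \<le> ((T B + t *\<^sub>R T X) \<bullet> (T B + t *\<^sub>R T X)) * (T X \<bullet> T X)"
        unfolding L_def by (rule Cauchy_Schwarz_ineq)
      also have "\<dots> \<le> Q t * (T X \<bullet> T X)"
        using \<epsilon>' by (intro mult_right_mono) (auto simp: Q_def)
      finally show ?thesis .
    qed
    have "p * q t powr (p/2 - 2) * (q t * (X \<bullet> X) + (p - 2) * (l t)\<^sup>2)
      \<le> p * q t powr (p/2 - 2) * (q t * (X \<bullet> X))"
      using p by (intro mult_left_mono) (auto simp: mult_nonpos_nonneg)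
    also have "\<dots> = p * (X \<bullet> X) * q t powr (p/2 - 1)"
      by (simp add: mult_ac flip: qe)
    also have "\<dots> \<le> p * (X \<bullet> X) * q t powr (p/2 - 1) * (M * ((p - 1) * K powr (p - 2) * \<kappa>\<^sup>2))"
      using M(2) p mult_left_mono[OF M(2), of "p * (X \<bullet> X) * q t powr (p/2 - 1)"] by simp
    also have "\<dots> = M * p * (p - 1) * (\<kappa>\<^sup>2 * (X \<bullet> X)) * (K powr (p - 2) * q t powr (p/2 - 1))"
      by (simp add: mult_ac)
    also have "\<dots> \<le> M * p * (p - 1) * (T X \<bullet> T X) * Q t powr (p/2 - 1)"
    proof (intro mult_mono mult_left_mono X2)
      have "K powr (p - 2) = (K powr 2) powr (p/2 - 1)"
        by (simp add: powr_powr algebra_simps)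
      then have "K powr (p - 2) * q t powr (p/2 - 1) = (K\<^sup>2 * q t) powr (p/2 - 1)"
        using K(1) pos by (simp add: powr_mult)
      also have "\<dots> \<le> Q t powr (p/2 - 1)"
        using p pos QX by (intro powr_mono2') auto
      finally show "K powr (p - 2) * q t powr (p/2 - 1) \<le> Q t powr (p/2 - 1)" .
    qed (use p M in auto)
    also have "\<dots> = M * (p * Q t powr (p/2 - 2) * (Q t * (T X \<bullet> T X) + (p - 2) * (Q t * (T X \<bullet> T X))))"
      by (simp add: algebra_simps flip: Qe)
    also have "\<dots> \<le> M * (p * Q t powr (p/2 - 2) * (Q t * (T X \<bullet> T X) + (p - 2) * (L t)\<^sup>2))"
      using p M CS by (intro mult_left_mono add_left_mono mult_left_mono_neg) auto
    finally show ?thesis .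
  qed
  then have "convex_on UNIV (\<lambda>t. M * Q t powr (p/2) - q t powr (p/2))"
    by (intro f''_ge0_imp_convex[OF convex_UNIV DERIV_diff[OF DERIV_cmult[OF D(1)] d(1)]
          DERIV_diff[OF DERIV_cmult[OF D(2)] d(2)]]) auto
  then show ?thesis by (simp add: q_def Q_def)
qed

text \<open>
  Convexity is a family of inequalities between values, so it passes to the limit \<open>\<epsilon> \<rightarrow> 0\<close>.
\<close>

lemma f_p_convex_on_line:
  fixes T :: "real^'d^'m \<Rightarrow> real^'k"
  assumes T: "linear T" and p: "1 < p" "p \<le> 2"
    and K: "K > 0" "\<And>B. norm (T B) \<le> K * norm B"
    and \<kappa>: "\<kappa> > 0" "\<kappa> * norm X \<le> norm (T X)"
    and C: "C powr p * ((p - 1) * K powr (p - 2) * \<kappa>\<^sup>2) \<ge> 1"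
  shows "convex_on UNIV (\<lambda>t. f_p T p C (B + t *\<^sub>R X))"
proof -
  let ?g = "\<lambda>\<epsilon> t. C powr p * (K\<^sup>2 * \<epsilon> + (T B + t *\<^sub>R T X) \<bullet> (T B + t *\<^sub>R T X)) powr (p/2)
    - (\<epsilon> + (B + t *\<^sub>R X) \<bullet> (B + t *\<^sub>R X)) powr (p/2)"
  have lim: "((\<lambda>\<epsilon>. ?g \<epsilon> t) \<longlongrightarrow> f_p T p C (B + t *\<^sub>R X)) (at_right 0)" for t
  proof -
    have "((\<lambda>\<epsilon>. ?g \<epsilon> t) \<longlongrightarrow> ?g 0 t) (at_right 0)"
      using p by (intro tendsto_intros tendsto_powr') (auto intro!: eventually_at_rightI[of 0 1])
    moreover have "?g 0 t = f_p T p C (B + t *\<^sub>R X)"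
      using T by (simp add: f_p_def norm_powr linear_add linear_cmul)
    ultimately show ?thesis by simp
  qed
  have "f_p T p C (B + (u * x + v * y) *\<^sub>R X) \<le> u * f_p T p C (B + x *\<^sub>R X) + v * f_p T p C (B + y *\<^sub>R X)"
    if uv: "u \<ge> 0" "v \<ge> 0" "u + v = 1" for x y u v :: real
  proof (rule tendsto_le[OF _ tendsto_add[OF tendsto_mult_left[OF lim] tendsto_mult_left[OF lim]] lim])
    show "\<forall>\<^sub>F \<epsilon> in at_right 0. ?g \<epsilon> (u * x + v * y) \<le> u * ?g \<epsilon> x + v * ?g \<epsilon> y"
    proof (rule eventually_at_rightI[of 0 1])
      fix \<epsilon> :: real assume "\<epsilon> \<in> {0<..<1}"
      then have "convex_on UNIV (?g \<epsilon>)"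
        by (intro convex_on_regularized[OF T p _ K \<kappa> _ C]) auto
      then show "?g \<epsilon> (u * x + v * y) \<le> u * ?g \<epsilon> x + v * ?g \<epsilon> y"
        using uv unfolding convex_on_def by (metis UNIV_I real_scaleR_def)
    qed auto
  qed auto
  then show ?thesis by (simp add: convex_on_def)
qed

lemma rank_one_convexI:
  fixes g :: "real^'d^'m \<Rightarrow> real"
  assumes "\<And>B X. rank X = 1 \<Longrightarrow> convex_on UNIV (\<lambda>t. g (B + t *\<^sub>R X))"
  shows "rank_one_convex g"
  unfolding rank_one_convex_def
proof (intro allI impI)
  fix A B :: "real^'d^'m" assume "rank (A - B) = 1"
  then have conv: "convex_on UNIV (\<lambda>t. g (B + t *\<^sub>R (A - B)))" by (rule assms)
  show "convex_on (closed_segment A B) g"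
    unfolding convex_on_def
  proof (intro conjI ballI allI impI)
    fix x y u v assume *: "x \<in> closed_segment A B" "y \<in> closed_segment A B" "0 \<le> u" "0 \<le> v" "u + v = (1::real)"
    from * obtain r s where rs: "x = B + r *\<^sub>R (A - B)" "y = B + s *\<^sub>R (A - B)"
      unfolding closed_segment_commute[of A] by (auto simp: closed_segment_def algebra_simps)
    have e: "u *\<^sub>R x + v *\<^sub>R y = (u + v) *\<^sub>R B + (u * r + v * s) *\<^sub>R (A - B)"
      unfolding rs by (simp add: algebra_simps)
    show "g (u *\<^sub>R x + v *\<^sub>R y) \<le> u * g x + v * g y"
      using conv * unfolding convex_on_def e by (simp add: rs)
  qed simp
qed

lemma C_min_finite:
  fixes T :: "real^'d^'m \<Rightarrow> real^'k"
  assumes T: "linear T" and p: "1 < p" "p \<le> 2" and ker: "\<not> (\<exists>A. rank A = 1 \<and> T A = 0)"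
  shows "C_min T p < \<infinity>"
proof -
  obtain \<kappa> where \<kappa>: "\<kappa> > 0" "\<And>X. rank X = 1 \<Longrightarrow> \<kappa> * norm X \<le> norm (T X)"
    using norm_lower_bound_rank_one[OF T ker] by blast
  obtain K where K: "K > 0" "\<And>B. norm (T B) \<le> K * norm B"
    using linear_bounded_pos[OF T] by blast
  let ?m = "(p - 1) * K powr (p - 2) * \<kappa>\<^sup>2"
  \<comment> \<open>solves \<open>C powr p * ?m = 1\<close>\<close>
  define C where "C = (1 / ?m) powr (1 / p)"
  have m: "?m > 0" using p K \<kappa> by simp
  have "C powr p = 1 / ?m"
    using p m by (simp add: C_def powr_powr)
  then have "C powr p * ?m = 1"
    using p K \<kappa> by simp
  then have "rank_one_convex (f_p T p C)"
    by (intro rank_one_convexI f_p_convex_on_line[OF T p K \<kappa>(1)] \<kappa>(2)) auto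
  moreover have "C \<ge> 0" by (simp add: C_def)
  ultimately have "C_min T p \<le> ereal C" unfolding C_min_def by (intro Inf_lower) auto
  then show ?thesis by auto
qed

section \<open>Matrices for which no constant is admissible\<close>

lemma rank_one_convexD:
  fixes g :: "real^'d^'m \<Rightarrow> real"
  assumes g: "rank_one_convex g" and X: "rank X = 1" and uv: "u \<ge> 0" "v \<ge> 0" "u + v = 1"
  shows "g (B + (u * r + v * s) *\<^sub>R X) \<le> u * g (B + r *\<^sub>R X) + v * g (B + s *\<^sub>R X)"
proof (cases "r = s")
  case True
  then have "u * r + v * s = s" using uv by (simp flip: distrib_right)
  then show ?thesis using True uv by (simp flip: distrib_right)
next
  case False
  let ?A = "B + r *\<^sub>R X" and ?B = "B + s *\<^sub>R X"
  have "?A - ?B = (r - s) *\<^sub>R X" by (simp add: algebra_simps)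
  then have "rank (?A - ?B) = 1" using False X by (simp add: rank_scaleR)
  then have "convex_on (closed_segment ?A ?B) g" using g by (simp add: rank_one_convex_def)
  then have "g (u *\<^sub>R ?A + v *\<^sub>R ?B) \<le> u * g ?A + v * g ?B"
    using uv unfolding convex_on_def by (meson ends_in_segment)
  moreover have "u *\<^sub>R ?A + v *\<^sub>R ?B = (u + v) *\<^sub>R B + (u * r + v * s) *\<^sub>R X"
    by (simp add: algebra_simps)
  ultimately show ?thesis using uv by simp
qed

lemma C_min_eq_infinity:
  assumes "\<And>C. C \<ge> 0 \<Longrightarrow> \<not> rank_one_convex (f_p T p C)"
  shows "C_min T p = \<infinity>"
proof -
  have "{ereal C |C. C \<ge> 0 \<and> rank_one_convex (f_p T p C)} = {}" using assms by auto
  show ?thesis unfolding C_min_def \<open>_ = {}\<close> by (simp add: top_ereal_def)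
qed

text \<open>
  On the line through a rank-one matrix of the kernel, \<^const>\<open>f_p\<close> is \<open>- (\<bar>t\<bar> powr p * norm A powr p)\<close>, which is not convex at \<open>t = 0\<close>.
\<close>

lemma C_min_infinite_rank_one:
  fixes T :: "real^'d^'m \<Rightarrow> real^'k"
  assumes T: "linear T" and p: "p > 1" and A: "rank A = 1" "T A = 0"
  shows "C_min T p = \<infinity>"
proof (rule C_min_eq_infinity)
  fix C :: real
  have "A \<noteq> 0" using A by auto
  then have "norm A powr p > 0" by simp
  moreover have "f_p T p C (t *\<^sub>R A) = - (\<bar>t\<bar> powr p * norm A powr p)" for t
    using A T by (simp add: f_p_def linear_cmul powr_mult)
  note this[of 1] this[of "-1"] this[of 0]
  ultimately show "\<not> rank_one_convex (f_p T p C)"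
    using rank_one_convexD[of "f_p T p C" A "1/2" "1/2" 0 1 "-1"] A by auto
qed

text \<open>
  By the parallelogram law the mean of the two squared norms exceeds \<open>norm A\<^sup>2\<close> by \<open>t\<^sup>2 * norm X\<^sup>2\<close>; the claim is the
  tangent inequality at \<open>norm A\<^sup>2\<close> for the convex function \<open>s powr (p/2)\<close>.
\<close>

lemma powr_mean_lower_bound:
  fixes A X :: "'a::real_inner"
  assumes p: "p > 2" and A: "A \<noteq> 0"
  shows "norm A powr p + p / 2 * norm A powr (p - 2) * (norm X)\<^sup>2 * t\<^sup>2
    \<le> (norm (A + t *\<^sub>R X) powr p + norm (A - t *\<^sub>R X) powr p) / 2"
proof -
  let ?h = "\<lambda>s. s powr (p / 2)" and ?a = "A \<bullet> A" and ?x = "X \<bullet> X"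
  have a: "?a > 0" using A by simp
  have conv: "convex_on {0<..} ?h"
  proof (rule f''_ge0_imp_convex)
    fix s :: real assume "s \<in> {0<..}"
    then have s: "s > 0" by simp
    show "(?h has_real_derivative p/2 * s powr (p/2 - 1)) (at s)"
      using s by (auto intro!: derivative_eq_intros)
    show "((\<lambda>s. p/2 * s powr (p/2 - 1)) has_real_derivative p/2 * ((p/2 - 1) * s powr (p/2 - 2))) (at s)"
      using s by (auto intro!: derivative_eq_intros)
    show "0 \<le> p/2 * ((p/2 - 1) * s powr (p/2 - 2))" using p by simp
  qed auto
  have tangent: "?h s \<ge> ?h ?a + p/2 * ?a powr (p/2 - 1) * (s - ?a)" if "s \<ge> 0" for s
  proof (cases "s = 0")
    case True
    have "?h ?a = ?a powr (p/2 - 1) * ?a" using a powr_add[of ?a "p/2 - 1" 1] by simp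
    then show ?thesis using True p a by (simp add: mult_ac)
  next
    case False
    have "?h s - ?h ?a \<ge> p/2 * ?a powr (p/2 - 1) * (s - ?a)"
    proof (rule convex_on_imp_above_tangent[OF conv])
      show "(?h has_real_derivative p/2 * ?a powr (p/2 - 1)) (at ?a within {0<..})"
        using a by (auto intro!: derivative_eq_intros)
    qed (use a False that in \<open>auto simp: interior_open\<close>)
    then show ?thesis by simp
  qed
  have n1: "?h ((A + t *\<^sub>R X) \<bullet> (A + t *\<^sub>R X)) = norm (A + t *\<^sub>R X) powr p"
   and n2: "?h ((A - t *\<^sub>R X) \<bullet> (A - t *\<^sub>R X)) = norm (A - t *\<^sub>R X) powr p"
   and n3: "?h ?a = norm A powr p" and n4: "?a powr (p/2 - 1) = norm A powr (p - 2)"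
    using norm_powr[of A "p - 2"] by (auto simp: norm_powr diff_divide_distrib)
  have "(A + t *\<^sub>R X) \<bullet> (A + t *\<^sub>R X) + (A - t *\<^sub>R X) \<bullet> (A - t *\<^sub>R X) - 2 * ?a = 2 * (?x * t\<^sup>2)"
    by (simp add: inner_simps algebra_simps power2_eq_square)
  then have "p/2 * ?a powr (p/2 - 1) * ((A + t *\<^sub>R X) \<bullet> (A + t *\<^sub>R X) - ?a)
    + p/2 * ?a powr (p/2 - 1) * ((A - t *\<^sub>R X) \<bullet> (A - t *\<^sub>R X) - ?a) = p/2 * ?a powr (p/2 - 1) * (2 * (?x * t\<^sup>2))"
    unfolding distrib_left[symmetric] by (simp add: algebra_simps power2_eq_square)
  with tangent[of "(A + t *\<^sub>R X) \<bullet> (A + t *\<^sub>R X)"] tangent[of "(A - t *\<^sub>R X) \<bullet> (A - t *\<^sub>R X)"]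
  show ?thesis
    unfolding n1 n2 n3 n4 by (simp add: power2_norm_eq_inner)
qed

text \<open>
  Convexity at \<open>A\<close> along a rank-one direction \<open>X\<close> forces a term of order \<open>t\<^sup>2\<close> to be bounded by a multiple of
  \<open>t powr p\<close>. For \<open>p > 2\<close> this fails as \<open>t\<close> tends to \<open>0\<close>, whatever the constant is.
\<close>

lemma C_min_infinite_p_gt_2:
  fixes T :: "real^'d^'m \<Rightarrow> real^'k"
  assumes T: "linear T" and p: "p > 2" and A: "A \<noteq> 0" "T A = 0"
  shows "C_min T p = \<infinity>"
proof (rule C_min_eq_infinity)
  fix C :: real
  obtain X :: "real^'d^'m" where X: "rank X = 1"
    using rank_outer[of "axis undefined 1 :: real^'m" "axis undefined 1 :: real^'d"]
    by (simp add: axis_eq_0_iff)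
  then have "X \<noteq> 0" by auto
  define m where "m = p / 2 * norm A powr (p - 2) * (norm X)\<^sup>2"
  define M where "M = C powr p * norm (T X) powr p"
  have m: "m > 0" using p A \<open>X \<noteq> 0\<close> by (simp add: m_def)
  show "\<not> rank_one_convex (f_p T p C)"
  proof
    assume "rank_one_convex (f_p T p C)"
    \<comment> \<open>divide the convexity inequality by \<open>t\<^sup>2\<close>\<close>
    have "m \<le> M * t powr (p - 2)" if t: "t > 0" for t
    proof -
      have f0: "f_p T p C A = - (norm A powr p)" using A by (simp add: f_p_def)
      have f1: "f_p T p C (A + t *\<^sub>R X) = M * t powr p - norm (A + t *\<^sub>R X) powr p"
        using A T t by (simp add: f_p_def linear_add linear_cmul powr_mult M_def)
      have f2: "f_p T p C (A - t *\<^sub>R X) = M * t powr p - norm (A - t *\<^sub>R X) powr p"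
        using A T t by (simp add: f_p_def linear_diff linear_cmul powr_mult M_def)
      have "f_p T p C A \<le> (f_p T p C (A + t *\<^sub>R X) + f_p T p C (A - t *\<^sub>R X)) / 2"
        using rank_one_convexD[OF \<open>rank_one_convex (f_p T p C)\<close> X, of "1/2" "1/2" A t "- t"] by simp
      then have "(norm (A + t *\<^sub>R X) powr p + norm (A - t *\<^sub>R X) powr p) / 2 \<le> norm A powr p + M * t powr p"
        unfolding f0 f1 f2 by (simp add: field_simps)
      with powr_mean_lower_bound[OF p A(1), of X t] have "m * t\<^sup>2 \<le> M * t powr p"
        by (simp add: m_def)
      also have "t powr p = t powr (p - 2) * t\<^sup>2"
        using t by (simp add: powr_diff)
      finally show ?thesis using t by simp
    qed
    then have "eventually (\<lambda>t. m \<le> M * t powr (p - 2)) (at_right 0)"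
      by (intro eventually_at_rightI[of 0 1]) auto
    moreover have "((\<lambda>t. M * t powr (p - 2)) \<longlongrightarrow> M * 0 powr (p - 2)) (at_right 0)"
      using p by (intro tendsto_intros tendsto_powr') (auto intro!: eventually_at_rightI[of 0 1])
    ultimately have "m \<le> M * 0 powr (p - 2)"
      by (intro tendsto_lowerbound) auto
    then show False using m by simp
  qed
qed

section \<open>Growth of the constant as the exponent tends to 1\<close>

text \<open>
  On the matrices \<open>s X + t Y\<close>, for which \<open>X\<close> and \<open>Y\<close> are rank-one directions, one has
  \<open>T (s X + t Y) = (s - t) T X\<close>. Two segments carry the argument: \<open>X\<close> is the midpoint of \<open>X + Y\<close> and \<open>X - Y\<close>,
  and \<open>X - Y\<close> lies between \<open>- (X + Y)\<close> and \<open>R X - Y\<close>. Eliminating the value at \<open>X - Y\<close>, and using that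
  \<^const>\<open>f_p\<close> is even, gives
  \<open>f X \<le> R / (R + 1) * f (X + Y) + f (R X - Y) / (R + 1)\<close>. In the terms that contain \<open>T\<close> only the factor
  \<open>(R + 1) powr (p - 1) - 1\<close> remains, which is of order \<open>p - 1\<close>.
\<close>

lemma rank_one_convex_imp_constant_bound:
  fixes T :: "real^'d^'m \<Rightarrow> real^'k"
  assumes T: "linear T" and X: "rank X = 1" and Y: "rank Y = 1" and ker: "T (X + Y) = 0"
    and R: "R \<ge> 1" and p: "p > 1"
    and conv: "rank_one_convex (f_p T p C)"
  shows "R / (R + 1) * norm (X + Y) powr p + norm (R *\<^sub>R X - Y) powr p / (R + 1) - norm X powr p
    \<le> C powr p * norm (T X) powr p * ((R + 1) powr (p - 1) - 1)"
proof -
  define M where "M = C powr p * norm (T X) powr p"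
  have TY: "T Y = - T X" using ker T by (simp add: linear_add eq_neg_iff_add_eq_0 add.commute)
  have f: "f_p T p C (s *\<^sub>R X + t *\<^sub>R Y) = M * \<bar>s - t\<bar> powr p - norm (s *\<^sub>R X + t *\<^sub>R Y) powr p" for s t
  proof -
    have "T (s *\<^sub>R X + t *\<^sub>R Y) = (s - t) *\<^sub>R T X"
      using T TY by (simp add: linear_add linear_cmul algebra_simps)
    then show ?thesis by (simp add: f_p_def powr_mult M_def)
  qed
  let ?f = "f_p T p C"
  have 1: "?f X \<le> (?f (X + Y) + ?f (X - Y)) / 2"
    using rank_one_convexD[OF conv Y, of "1/2" "1/2" X 1 "-1"] by simp
  have 2: "?f (X - Y) \<le> (R - 1) / (R + 1) * ?f (- X - Y) + 2 / (R + 1) * ?f (R *\<^sub>R X - Y)"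
  proof -
    have "R + 1 \<noteq> 0" using R by simp
    then have "(R - 1) / (R + 1) * - 1 + 2 / (R + 1) * R = 1" "(R - 1) / (R + 1) + 2 / (R + 1) = 1"
      by (simp_all add: divide_simps)
    then show ?thesis
      using rank_one_convexD[OF conv X, of "(R - 1) / (R + 1)" "2 / (R + 1)" "- Y" "-1" R] R
      by (simp add: algebra_simps)
  qed
  have f1: "?f X = M - norm X powr p" using f[of 1 0] by simp
  have f2: "?f (X + Y) = - (norm (X + Y) powr p)" using f[of 1 1] p by simp
  have f3: "?f (- X - Y) = - (norm (X + Y) powr p)"
    using f[of "-1" "-1"] p by (simp add: norm_minus_commute norm_minus_cancel[of "X + Y", symmetric] del: norm_minus_cancel)
  have f4: "?f (R *\<^sub>R X - Y) = M * (R + 1) powr p - norm (R *\<^sub>R X - Y) powr p"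
    using f[of R "-1"] R by simp
  have e: "(R + 1) powr p = (R + 1) powr (p - 1) * (R + 1)"
    using R powr_add[of "R + 1" "p - 1" 1] by simp
  have "2 * ?f X \<le> ?f (X + Y) + ((R - 1) / (R + 1) * ?f (- X - Y) + 2 / (R + 1) * ?f (R *\<^sub>R X - Y))"
    using 1 2 by simp
  then have "?f X \<le> R / (R + 1) * - (norm (X + Y) powr p) + ?f (R *\<^sub>R X - Y) / (R + 1)"
    unfolding f2 f3 using R by (simp add: divide_simps) (simp add: algebra_simps)
  also have "?f (R *\<^sub>R X - Y) / (R + 1) = M * (R + 1) powr (p - 1) - norm (R *\<^sub>R X - Y) powr p / (R + 1)"
    unfolding f4 e using R by (simp add: field_simps)
  finally show ?thesis
    unfolding f1 M_def[symmetric] by (simp add: algebra_simps)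
qed

text \<open>
  Taking the \<open>p\<close>-th root of \<open>\<kappa> / (p - 1)\<close> costs only a bounded factor near \<open>p = 1\<close>, because \<open>x powr (- x) \<le> exp 1 \<le> 3\<close>
  for \<open>x > 0\<close>.
\<close>

lemma blow_up_of_power_bound:
  fixes \<kappa> p Z :: real
  assumes \<kappa>: "\<kappa> > 0" and p: "1 < p" and Z: "Z \<ge> 0" "\<kappa> / (p - 1) \<le> Z powr p"
  shows "min 1 (\<kappa> / 3) / (p - 1) \<le> Z"
proof (rule ccontr)
  define c where "c = min 1 (\<kappa> / 3)"
  have c: "0 < c" "c \<le> 1" "c * 3 \<le> \<kappa>" using \<kappa> by (auto simp: c_def)
  have bound: "(p - 1) powr (- (p - 1)) \<le> 3"
  proof -
    have "ln (1 / (p - 1)) \<le> 1 / (p - 1) - 1" using p by (intro ln_le_minus_one) auto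
    then have "(p - 1) * ln (1 / (p - 1)) \<le> (p - 1) * (1 / (p - 1) - 1)"
      using p by (intro mult_left_mono) auto
    also have "\<dots> \<le> 1" using p by (simp add: right_diff_distrib)
    finally have "exp ((p - 1) * ln (1 / (p - 1))) \<le> exp 1" by simp
    also have "\<dots> \<le> (3::real)" by (rule exp_le)
    finally show ?thesis using p by (simp add: powr_def ln_div algebra_simps)
  qed
  assume "\<not> min 1 (\<kappa> / 3) / (p - 1) \<le> Z"
  then have "Z powr p < (c / (p - 1)) powr p"
    using Z p by (intro powr_less_mono2) (auto simp: c_def)
  also have "\<dots> = c powr p * (p - 1) powr (- (p - 1)) / (p - 1)"
    using p c by (simp add: powr_divide powr_diff powr_minus field_simps)
  also have "\<dots> \<le> c * 3 / (p - 1)"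
  proof (intro divide_right_mono mult_mono)
    show "c powr p \<le> c" using powr_mono'[of 1 p c] c p by simp
  qed (use bound c p in auto)
  also have "\<dots> \<le> \<kappa> / (p - 1)" using c p by (intro divide_right_mono) auto
  finally show False using Z by simp
qed

text \<open>
  At \<open>p = 1\<close> the left-hand side of the inequality \<open>rank_one_convex_imp_constant_bound\<close> is at least
  \<open>(R * norm A - norm X - norm Y) / (R + 1)\<close>, which is positive once \<open>R\<close> is large. Fixing such an \<open>R\<close>, continuity in \<open>p\<close>
  keeps it bounded away from zero, while the factor of the constant on the right-hand side is of order \<open>p - 1\<close>.
\<close>

lemma C_min_blow_up_at_1:
  fixes T :: "real^'d^'m \<Rightarrow> real^'k"
  assumes T: "linear T" and A: "A \<noteq> 0" "rank A \<le> 2" "T A = 0"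
  shows "\<exists>c>0. \<forall>\<^sub>F p in at_right 1. ereal (c * (pstar p - 1)) \<le> C_min T p"
proof -
  obtain a b a' b' where "A = outer a b + outer a' b'" "a \<noteq> 0" "b \<noteq> 0" "a' \<noteq> 0" "b' \<noteq> 0"
    using rank_le_2_split A by blast
  then obtain X Y where XY: "A = X + Y" "rank X = 1" "rank Y = 1"
    using rank_outer by metis
  \<comment> \<open>large enough for \<open>R * norm A > norm X + norm Y\<close>\<close>
  define R where "R = 1 + (norm X + norm Y) / norm A"
  have nA: "norm A > 0" using A by simp
  then have R: "R \<ge> 1" by (simp add: R_def)
  define \<rho> where "\<rho> p = R / (R + 1) * norm A powr p + norm (R *\<^sub>R X - Y) powr p / (R + 1) - norm X powr p" for p
  have \<rho>1: "\<rho> 1 > 0"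
  proof -
    have "norm X + norm Y < R * norm A" using nA by (simp add: R_def field_simps)
    moreover have "R * norm X - norm Y \<le> norm (R *\<^sub>R X - Y)"
      using norm_triangle_ineq2[of "R *\<^sub>R X" Y] R by simp
    ultimately have "norm X * (R + 1) < R * norm A + norm (R *\<^sub>R X - Y)"
      by (simp add: algebra_simps)
    then have "norm X < (R * norm A + norm (R *\<^sub>R X - Y)) / (R + 1)"
      using R by (simp add: pos_less_divide_eq)
    then show ?thesis by (simp add: \<rho>_def add_divide_distrib)
  qed
  have pos: "norm A \<noteq> 0" "norm X \<noteq> 0" using A XY by auto
  have "(\<rho> \<longlongrightarrow> \<rho> 1) (at_right 1)"
    unfolding \<rho>_def[abs_def]
    by (intro tendsto_intros) (use R pos in auto)
  then have ev1: "\<forall>\<^sub>F p in at_right 1. \<rho> p > \<rho> 1 / 2"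
    using \<rho>1 by (intro order_tendstoD) auto
  define L where "L = ln (R + 1)"
  have L: "L > 0" using R by (simp add: L_def)
  define \<kappa> where "\<kappa> = \<rho> 1 / (4 * L)"
  have \<kappa>: "\<kappa> > 0" using L \<rho>1 by (simp add: \<kappa>_def)
  define c0 where "c0 = min 1 (\<kappa> / 3)"
  have c0: "c0 > 0" using \<kappa> by (simp add: c0_def)
  \<comment> \<open>adding \<open>1\<close> covers the case \<open>T X = 0\<close>, in which no constant is admissible near \<open>1\<close>\<close>
  define c where "c = c0 / (norm (T X) + 1)"
  have "c > 0" using c0 by (simp add: c_def add_nonneg_pos)
  moreover have "\<forall>\<^sub>F p in at_right 1. ereal (c * (pstar p - 1)) \<le> C_min T p"
  proof -
    have ev2: "\<forall>\<^sub>F p in at_right 1. p \<in> {1<..<1 + min 1 (1 / L)}"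
      using L by (intro eventually_at_right_real) auto
    show ?thesis
      using ev1 ev2
    proof eventually_elim
      case (elim p)
      have p: "p > 1" "p < 2" "p - 1 < 1 / L" using elim by auto
      then have pL: "(p - 1) * L \<le> 1" using L by (simp add: pos_less_divide_eq)
      have ps: "pstar p - 1 = 1 / (p - 1)"
      proof -
        have "p * (p - 1) \<le> p" using p by simp
        then have "p \<le> p / (p - 1)" using p by (simp add: pos_le_divide_eq)
        then show ?thesis using p by (simp add: pstar_def field_simps)
      qed
      have "c * (pstar p - 1) \<le> C" if C: "C \<ge> 0" "rank_one_convex (f_p T p C)" for C
      proof -
        let ?Z = "C * norm (T X)"
        have "(R + 1) powr (p - 1) = exp ((p - 1) * L)"
          using R by (simp add: powr_def L_def)
        also have "\<dots> \<le> 1 + (p - 1) * L + ((p - 1) * L)\<^sup>2"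
          using p pL L by (intro exp_bound) auto
        also have "((p - 1) * L)\<^sup>2 \<le> (p - 1) * L"
          using p pL L by (simp add: power2_eq_square mult_left_le)
        finally have pw: "(R + 1) powr (p - 1) - 1 \<le> 2 * ((p - 1) * L)" by (simp add: mult.commute)
        have "\<rho> p \<le> C powr p * norm (T X) powr p * ((R + 1) powr (p - 1) - 1)"
          unfolding \<rho>_def XY(1)
          using A(3) XY p C R by (intro rank_one_convex_imp_constant_bound T) auto
        also have "\<dots> \<le> C powr p * norm (T X) powr p * (2 * ((p - 1) * L))"
          using pw by (intro mult_left_mono) auto
        finally have "\<rho> 1 / 2 \<le> ?Z powr p * (2 * ((p - 1) * L))"
          using elim C by (simp add: powr_mult)
        then have "\<kappa> / (p - 1) \<le> ?Z powr p"
          using p L by (simp add: \<kappa>_def field_simps)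
        then have "c0 / (p - 1) \<le> ?Z"
          unfolding c0_def using C p \<kappa> by (intro blow_up_of_power_bound) auto
        also have "\<dots> \<le> C * (norm (T X) + 1)" using C by (intro mult_left_mono) auto
        finally show ?thesis
          using p unfolding ps c_def by (simp add: pos_divide_le_eq add_nonneg_pos mult_ac)
      qed
      then show ?case unfolding C_min_def by (intro Inf_greatest) auto
    qed
  qed
  ultimately show ?thesis by blast
qed

section \<open>Smooth functions with compact support\<close>

text \<open>
  The powers of \<open>inverse t\<close> make the family closed under differentiation up to linear combinations.
\<close>

definition flat :: "nat \<Rightarrow> real \<Rightarrow> real" where
  "flat k t = (if t > 0 then exp (- inverse t) * inverse t ^ k else 0)"

lemma flat_tendsto_0: "(flat k \<longlongrightarrow> 0) (at 0)"
proof (rule filterlim_split_at)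
  show "(flat k \<longlongrightarrow> 0) (at_left 0)"
    by (rule tendsto_eventually) (auto simp: flat_def intro!: eventually_at_leftI[of "-1"])
  have "((\<lambda>t. (inverse t ^ k / exp (inverse t)) :: real) \<longlongrightarrow> 0) (at_right 0)"
    by (rule filterlim_compose[OF tendsto_power_div_exp_0 filterlim_inverse_at_top_right])
  then show "(flat k \<longlongrightarrow> 0) (at_right 0)"
    by (rule Lim_transform_eventually)
      (auto simp: flat_def exp_minus field_simps intro!: eventually_at_rightI[of 0 1])
qed

lemma DERIV_flat: "(flat k has_real_derivative flat (k + 2) t - real k * flat (k + 1) t) (at t)"
proof -
  consider "t < 0" | "t > 0" | "t = 0" by linarith
  then show ?thesis
  proof cases
    case 1
    have "(flat k has_real_derivative 0) (at t)"
      by (rule has_field_derivative_transform_within_open[of "\<lambda>_. 0" _ _ "{..<0}"])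
        (use 1 in \<open>auto simp: flat_def\<close>)
    then show ?thesis using 1 by (simp add: flat_def)
  next
    case 2
    have "((\<lambda>t. exp (- inverse t) * inverse t ^ k) has_real_derivative
        flat (k + 2) t - real k * flat (k + 1) t) (at t)"
    proof (cases k)
      case 0
      then show ?thesis using 2
        by (auto intro!: derivative_eq_intros simp: flat_def power2_eq_square)
    next
      case (Suc m)
      then show ?thesis using 2
        by (auto intro!: derivative_eq_intros simp: flat_def power2_eq_square field_simps) (cases m; simp)
    qed
    then show ?thesis
      by (rule has_field_derivative_transform_within_open[of _ _ _ "{0<..}"])
        (use 2 in \<open>auto simp: flat_def\<close>)
  next
    case 3
    \<comment> \<open>for \<open>h \<noteq> 0\<close>, the quotient \<open>flat k h / h\<close> is \<open>flat (k + 1) h\<close>\<close>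
    have "((\<lambda>h. flat k h / h) \<longlongrightarrow> 0) (at 0)"
      using flat_tendsto_0[of "k + 1"]
      by (rule Lim_transform_eventually) (simp add: flat_def eventually_at_filter field_simps)
    then show ?thesis using 3
      by (simp add: DERIV_def flat_def)
  qed
qed

text \<open>
  Not all smooth functions, but a class that is visibly closed under partial derivatives and rich enough for the
  construction: a polynomial algebra over coordinates, plane waves and cut-offs on the unit ball. Closure under
  derivatives makes smoothness of every order a single induction.
\<close>

inductive smooth_fun :: "(real^'d \<Rightarrow> real) \<Rightarrow> bool" where
  smooth_const: "smooth_fun (\<lambda>x. r)"
| smooth_inner: "smooth_fun (\<lambda>x. x \<bullet> b)"
| smooth_sin: "smooth_fun (\<lambda>x. sin (x \<bullet> b + r))"
| smooth_flat: "smooth_fun (\<lambda>x. flat k (1 - x \<bullet> x))"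
| smooth_add: "smooth_fun f \<Longrightarrow> smooth_fun g \<Longrightarrow> smooth_fun (\<lambda>x. f x + g x)"
| smooth_mult: "smooth_fun f \<Longrightarrow> smooth_fun g \<Longrightarrow> smooth_fun (\<lambda>x. f x * g x)"

lemma smooth_cos: "smooth_fun (\<lambda>x. cos (x \<bullet> b + r))"
proof -
  have "sin (x \<bullet> b + (r + pi/2)) = cos (x \<bullet> b + r)" for x
    using sin_add[of "x \<bullet> b + r" "pi/2"] by (simp add: add.assoc)
  then show ?thesis using smooth_sin[of b "r + pi/2"] by simp
qed

lemma smooth_prod: "finite I \<Longrightarrow> (\<And>i. i \<in> I \<Longrightarrow> smooth_fun (f i)) \<Longrightarrow> smooth_fun (\<lambda>x. \<Prod>i\<in>I. f i x)"
  by (induction I rule: finite_induct) (auto intro: smooth_fun.intros)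

lemma smooth_fun_gradient:
  fixes f :: "real^'d \<Rightarrow> real"
  assumes "smooth_fun f"
  obtains g where "\<And>x. (f has_derivative (\<lambda>h. g x \<bullet> h)) (at x)" "\<And>i. smooth_fun (\<lambda>x. g x $ i)"
proof -
  have "\<exists>g. (\<forall>x. (f has_derivative (\<lambda>h. g x \<bullet> h)) (at x)) \<and> (\<forall>i. smooth_fun (\<lambda>x. g x $ i))"
    using assms
  proof (induction f rule: smooth_fun.induct)
    case (smooth_const r)
    show ?case by (rule exI[of _ "\<lambda>x. 0"]) (auto intro: smooth_fun.intros)
  next
    case (smooth_inner b)
    show ?case
      by (rule exI[of _ "\<lambda>x. b"])
        (auto intro!: smooth_fun.intros derivative_eq_intros simp: inner_commute)
  next
    case (smooth_sin b r)
    show ?case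
      by (rule exI[of _ "\<lambda>x. cos (x \<bullet> b + r) *\<^sub>R b"])
        (auto intro!: smooth_fun.intros smooth_cos derivative_eq_intros simp: inner_commute)
  next
    case (smooth_flat k)
    let ?s = "\<lambda>x. flat (k + 2) (1 - x \<bullet> x) + - real k * flat (k + 1) (1 - x \<bullet> x) :: real"
    have "((\<lambda>x. flat k (1 - x \<bullet> x)) has_derivative (\<lambda>h. (?s x * - 2) *\<^sub>R x \<bullet> h)) (at x)" for x :: "real^'d"
    proof -
      have "((\<lambda>x. 1 - x \<bullet> x) has_derivative (\<lambda>h. - 2 * (x \<bullet> h))) (at x)"
        by (auto intro!: derivative_eq_intros simp: inner_commute)
      from DERIV_compose_FDERIV[OF DERIV_flat this]
      show ?thesis by (rule has_derivative_eq_rhs) (simp add: fun_eq_iff algebra_simps)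
    qed
    moreover have "smooth_fun (\<lambda>x. ((?s x * - 2) *\<^sub>R x) $ i)" for i :: 'd
    proof -
      have "smooth_fun (\<lambda>x. ?s x * (- 2) * (x \<bullet> axis i 1))"
        by (intro smooth_fun.intros)
      then show ?thesis by (simp add: inner_axis)
    qed
    ultimately show ?case
      by (intro exI[of _ "\<lambda>x. (?s x * - 2) *\<^sub>R x"] conjI allI)
  next
    case (smooth_add f f')
    then obtain g g' where
      "\<And>x. (f has_derivative (\<lambda>h. g x \<bullet> h)) (at x)" "\<And>i. smooth_fun (\<lambda>x. g x $ i)"
      "\<And>x. (f' has_derivative (\<lambda>h. g' x \<bullet> h)) (at x)" "\<And>i. smooth_fun (\<lambda>x. g' x $ i)" by blast
    then show ?case
      by (intro exI[of _ "\<lambda>x. g x + g' x"])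
        (auto intro!: smooth_fun.intros derivative_eq_intros simp: inner_add_left)
  next
    case (smooth_mult f f')
    then obtain g g' where
      "\<And>x. (f has_derivative (\<lambda>h. g x \<bullet> h)) (at x)" "\<And>i. smooth_fun (\<lambda>x. g x $ i)"
      "\<And>x. (f' has_derivative (\<lambda>h. g' x \<bullet> h)) (at x)" "\<And>i. smooth_fun (\<lambda>x. g' x $ i)" by blast
    with smooth_mult(1,2) show ?case
      by (intro exI[of _ "\<lambda>x. f x *\<^sub>R g' x + f' x *\<^sub>R g x"])
        (auto intro!: smooth_fun.intros derivative_eq_intros simp: inner_add_left)
  qed
  then show ?thesis using that by blast
qed

lemma smooth_fun_continuous: "smooth_fun f \<Longrightarrow> continuous_on S f"
  by (metis smooth_fun_gradient has_derivative_continuous continuous_at_imp_continuous_on)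

definition smooth_map :: "(real^'d \<Rightarrow> real^'m) \<Rightarrow> bool" where
  "smooth_map u \<longleftrightarrow> (\<forall>i. smooth_fun (\<lambda>x. u x $ i))"

lemma grad_eqI:
  fixes u :: "real^'d \<Rightarrow> real^'m"
  assumes "(u has_derivative D) (at x)"
  shows "grad u x = matrix D"
  using frechet_derivative_at[OF assms] by (simp add: grad_def jacobian_def)

lemma smooth_map_derivative:
  fixes u :: "real^'d \<Rightarrow> real^'m"
  assumes "smooth_map u"
  shows "(u has_derivative (\<lambda>h. grad u x *v h)) (at x)" "smooth_fun (\<lambda>x. grad u x $ i $ j)"
proof -
  have "\<exists>g. (\<forall>x. ((\<lambda>x. u x $ i) has_derivative (\<lambda>h. g x \<bullet> h)) (at x)) \<and> (\<forall>j. smooth_fun (\<lambda>x. g x $ j))" for i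
    using assms smooth_fun_gradient[of "\<lambda>x. u x $ i"] unfolding smooth_map_def by metis
  then obtain G where G: "\<And>i x. ((\<lambda>x. u x $ i) has_derivative (\<lambda>h. G i x \<bullet> h)) (at x)"
    "\<And>i j. smooth_fun (\<lambda>x. G i x $ j)" by metis
  define M where "M x = (\<chi> i j. G i x $ j)" for x
  have D: "(u has_derivative (\<lambda>h. M x *v h)) (at x)" for x
  proof -
    have "(M x *v h) $ i = G i x \<bullet> h" for h i
      by (simp add: M_def matrix_vector_mult_def inner_vec_def)
    then show ?thesis
      unfolding has_derivative_componentwise_within[of u]
      using G(1) by (auto simp: Basis_vec_def inner_axis)
  qed
  have "grad u x = M x" for x using grad_eqI[OF D] by simp
  then show "(u has_derivative (\<lambda>h. grad u x *v h)) (at x)" "smooth_fun (\<lambda>x. grad u x $ i $ j)"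
    using D G(2) by (simp_all add: M_def)
qed

lemma smooth_map_Ck: "smooth_map u \<Longrightarrow> Ck n u"
proof (induction n arbitrary: u)
  case 0
  then show ?case
    using smooth_map_derivative(1) has_derivative_continuous
    by (metis Ck.simps(1) continuous_at_imp_continuous_on)
next
  case (Suc n)
  note D = smooth_map_derivative[OF Suc.prems]
  have "u differentiable_on UNIV"
    using D(1) by (auto simp: differentiable_on_def differentiable_def)
  moreover have "smooth_map (\<lambda>x. frechet_derivative u (at x) (axis j 1))" for j
  proof -
    have "frechet_derivative u (at x) (axis j 1) $ i = grad u x $ i $ j" for x i
      using frechet_derivative_at[OF D(1), of x, symmetric]
      by (simp add: matrix_vector_mult_basis column_def)
    then show ?thesis unfolding smooth_map_def using D(2) by simp
  qed
  ultimately show ?case using Suc.IH by simp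
qed

lemma smooth_map_test_function:
  fixes u :: "real^'d \<Rightarrow> real^'m"
  assumes "smooth_map u" "\<And>x. norm x \<ge> 1 \<Longrightarrow> u x = 0"
  shows "test_function u"
proof -
  have "{x. u x \<noteq> 0} \<subseteq> cball 0 1" using assms(2) by force
  then have "bounded {x. u x \<noteq> 0}" using bounded_cball bounded_subset by blast
  then show ?thesis
    using assms(1) by (simp add: test_function_def smooth_map_Ck compact_closure)
qed

text \<open>
  On the sphere itself the gradient is left out, so that the complement of the closed ball is an open set on which \<open>u\<close> vanishes.
\<close>

lemma grad_eq_0_outside:
  fixes u :: "real^'d \<Rightarrow> real^'m"
  assumes "\<And>x. norm x \<ge> 1 \<Longrightarrow> u x = 0" "norm x > 1"
  shows "grad u x = 0"
proof -
  have "open {x :: real^'d. norm x > 1}" by (intro open_Collect_less continuous_intros)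
  then have "(u has_derivative (\<lambda>_. 0)) (at x)"
    by (rule has_derivative_transform_within_open[OF has_derivative_const])
      (use assms in auto)
  then show ?thesis by (simp add: grad_eqI matrix_def vec_eq_iff)
qed

lemma continuous_on_grad: "smooth_map u \<Longrightarrow> continuous_on S (grad u)"
proof -
  assume "smooth_map u"
  then have "continuous_on S (\<lambda>x. \<chi> i j. grad u x $ i $ j)"
    by (intro continuous_on_vec_lambda smooth_fun_continuous smooth_map_derivative(2))
  then show ?thesis by (simp add: vec_lambda_eta)
qed

lemma smooth_map_add_scaleR:
  assumes "smooth_map u" "smooth_fun s"
  shows "smooth_map (\<lambda>x. u x + s x *\<^sub>R a)"
  using assms unfolding smooth_map_def by (auto intro!: smooth_fun.intros)

lemma grad_add_scaleR:
  fixes u :: "real^'d \<Rightarrow> real^'m"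
  assumes "smooth_map u" "(s has_derivative (\<lambda>h. g \<bullet> h)) (at x)"
  shows "grad (\<lambda>x. u x + s x *\<^sub>R a) x = grad u x + outer a g"
proof -
  have "((\<lambda>x. u x + s x *\<^sub>R a) has_derivative (\<lambda>h. grad u x *v h + (g \<bullet> h) *\<^sub>R a)) (at x)"
    using smooth_map_derivative(1)[OF assms(1)] assms(2) by (auto intro!: derivative_eq_intros)
  then show ?thesis
    by (simp add: grad_eqI matrix_def vec_eq_iff matrix_vector_mult_basis column_def inner_axis mult.commute)
qed

lemma bounded_gradient:
  fixes f :: "real^'d \<Rightarrow> real"
  assumes "smooth_fun f" "\<And>x. norm x \<ge> 1 \<Longrightarrow> f x = 0"
  obtains g K where "\<And>x. (f has_derivative (\<lambda>h. g x \<bullet> h)) (at x)" "\<And>x. norm (g x) \<le> K"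
proof -
  obtain g where g: "\<And>x. (f has_derivative (\<lambda>h. g x \<bullet> h)) (at x)" "\<And>i. smooth_fun (\<lambda>x. g x $ i)"
    using smooth_fun_gradient[OF assms(1)] by blast
  have "continuous_on (cball 0 1) (\<lambda>x. \<chi> i. g x $ i)"
    by (intro continuous_on_vec_lambda smooth_fun_continuous g(2))
  then have "continuous_on (cball 0 1) g" by simp
  then have "bounded (g ` cball 0 1)"
    by (intro compact_imp_bounded compact_continuous_image) auto
  then obtain K where K: "K > 0" "\<And>x. norm x \<le> 1 \<Longrightarrow> norm (g x) \<le> K"
    unfolding bounded_pos by (auto simp: image_iff)
  have "g x = 0" if "norm x > 1" for x
  proof -
    have "open {x :: real^'d. norm x > 1}" by (intro open_Collect_less continuous_intros)
    then have "(f has_derivative (\<lambda>_. 0)) (at x)"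
      by (rule has_derivative_transform_within_open[OF has_derivative_const])
        (use that assms(2) in auto)
    from has_derivative_unique[OF g(1) this] have "g x \<bullet> g x = 0" by (rule fun_cong)
    then show ?thesis by simp
  qed
  then have "norm (g x) \<le> K" for x
    using K by (cases "norm x \<le> 1") auto
  then show ?thesis using that g(1) by blast
qed

section \<open>Maps whose gradients follow a Riesz product\<close>

text \<open>
  The factors \<open>1 + c j\<close> are nonnegative when the \<open>c j\<close> are cosines. Thus the partial Riesz products have \<open>L\<^sup>1\<close>-norm equal to
  their mean, which is what makes them useful here.
\<close>

definition riesz :: "(nat \<Rightarrow> real) \<Rightarrow> nat \<Rightarrow> real" where
  "riesz c n = (\<Prod>j<n. 1 + c j)"

lemma riesz_telescope: "(\<Sum>k<n. c k * riesz c k) = riesz c n - 1"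
  by (induction n) (simp_all add: riesz_def algebra_simps)

lemma riesz_cong: "(\<And>j. j < n \<Longrightarrow> c j = c' j) \<Longrightarrow> riesz c n = riesz c' n"
  by (simp add: riesz_def)

text \<open>
  The phase is a multiple of \<open>pi/2\<close> that is chosen for each \<open>k\<close> separately. Averaging over the four choices replaces
  the approximate independence of rapidly oscillating waves by an exact identity at every point.
\<close>

definition wave :: "(nat \<Rightarrow> real^'d) \<Rightarrow> (nat \<Rightarrow> real) \<Rightarrow> (nat \<Rightarrow> nat) \<Rightarrow> real^'d \<Rightarrow> nat \<Rightarrow> real" where
  "wave e l \<tau> x k = cos (l k * (x \<bullet> e k) + real (\<tau> k) * (pi / 2))"

definition bump :: "real^'d \<Rightarrow> real" where
  "bump x = flat 0 (1 - x \<bullet> x)"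

lemma smooth_bump: "smooth_fun bump"
  using smooth_flat[of 0] by (simp add: bump_def[abs_def])

lemma bump_nonneg: "bump x \<ge> 0"
  by (simp add: bump_def flat_def)

lemma bump_eq_0: "norm x \<ge> 1 \<Longrightarrow> bump x = 0"
  by (auto simp: bump_def flat_def dot_square_norm power_less_one_iff abs_square_less_1)

lemma smooth_wave: "smooth_fun (\<lambda>x. wave e l \<tau> x k)"
  using smooth_cos[of "l k *\<^sub>R e k" "real (\<tau> k) * (pi / 2)"] by (simp add: wave_def)

lemma smooth_riesz_wave: "smooth_fun (\<lambda>x. riesz (wave e l \<tau> x) n)"
  unfolding riesz_def by (intro smooth_prod smooth_fun.intros smooth_wave) auto

text \<open>
  A new summand \<open>sin (\<Lambda> * (x \<bullet> e n) + \<dots>) / \<Lambda> * P x *\<^sub>R v n\<close> adds to the gradient the wanted matrix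
  \<open>cos (\<dots>) * P x *\<^sub>R outer (v n) (e n)\<close> and the error \<open>sin (\<dots>) / \<Lambda> *\<^sub>R outer (v n) (\<nabla> P x)\<close>. Here \<open>P\<close> is the cut-off
  Riesz product of the earlier waves; its gradient is bounded, so a high frequency \<open>\<Lambda>\<close> makes the error as small as
  desired. One frequency has to serve all of the finitely many phases, hence the finite set \<open>\<T>\<close>.
\<close>

lemma oscillating_maps:
  fixes v :: "nat \<Rightarrow> real^'m" and e :: "nat \<Rightarrow> real^'d"
  assumes fin: "finite \<T>" and "\<epsilon> > 0"
  shows "\<exists>l. \<forall>\<tau>\<in>\<T>. \<exists>u. smooth_map u \<and> (\<forall>x. norm x \<ge> 1 \<longrightarrow> u x = 0) \<and>
    (\<forall>x. norm (grad u x - bump x *\<^sub>R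
       (\<Sum>k<n. (wave e l \<tau> x k * riesz (wave e l \<tau> x) k) *\<^sub>R outer (v k) (e k))) \<le> \<epsilon>)"
  using \<open>\<epsilon> > 0\<close>
proof (induction n arbitrary: \<epsilon>)
  case 0
  let ?u = "\<lambda>x :: real^'d. 0 :: real^'m"
  have "smooth_map ?u" by (auto simp: smooth_map_def intro: smooth_fun.intros)
  moreover have "grad ?u x = 0" for x
    by (simp add: grad_eqI[OF has_derivative_const] matrix_def vec_eq_iff)
  ultimately show ?case using 0 by (intro exI ballI) auto
next
  case (Suc n)
  define G where "G l \<tau> x m = (\<Sum>k<m. (wave e l \<tau> x k * riesz (wave e l \<tau> x) k) *\<^sub>R outer (v k) (e k))" for l \<tau> x m
  have "\<epsilon> / 2 > 0" using Suc.prems by simp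
  from Suc.IH[OF this, folded G_def] obtain l where
    "\<forall>\<tau>\<in>\<T>. \<exists>u. smooth_map u \<and> (\<forall>x. norm x \<ge> 1 \<longrightarrow> u x = 0) \<and>
      (\<forall>x. norm (grad u x - bump x *\<^sub>R G l \<tau> x n) \<le> \<epsilon> / 2)" by blast
  then obtain U where U: "\<And>\<tau>. \<tau> \<in> \<T> \<Longrightarrow> smooth_map (U \<tau>)"
    "\<And>\<tau> x. \<tau> \<in> \<T> \<Longrightarrow> norm x \<ge> 1 \<Longrightarrow> U \<tau> x = 0"
    "\<And>\<tau> x. \<tau> \<in> \<T> \<Longrightarrow> norm (grad (U \<tau>) x - bump x *\<^sub>R G l \<tau> x n) \<le> \<epsilon> / 2"
    by metis
  define P where "P \<tau> x = riesz (wave e l \<tau> x) n * bump x" for \<tau> x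
  have smP: "smooth_fun (P \<tau>)" for \<tau>
    unfolding P_def by (intro smooth_fun.intros smooth_riesz_wave smooth_bump)
  have P0: "norm x \<ge> 1 \<Longrightarrow> P \<tau> x = 0" for \<tau> x by (simp add: P_def bump_eq_0)
  have "\<exists>g K. (\<forall>x. (P \<tau> has_derivative (\<lambda>h. g x \<bullet> h)) (at x)) \<and> (\<forall>x. norm (g x) \<le> K)" for \<tau>
    using bounded_gradient[OF smP P0] by metis
  then obtain g K where g: "\<And>\<tau> x. (P \<tau> has_derivative (\<lambda>h. g \<tau> x \<bullet> h)) (at x)"
    and K: "\<And>\<tau> x. norm (g \<tau> x) \<le> K \<tau>" by metis
  \<comment> \<open>the summand \<open>1\<close> keeps the bound positive even if all gradients vanish\<close>
  define K' where "K' = 1 + (\<Sum>\<tau>\<in>\<T>. K \<tau>)"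
  have K0: "K \<tau> \<ge> 0" for \<tau> using K[of \<tau> undefined] norm_ge_zero order_trans by blast
  have K': "norm (g \<tau> x) \<le> K'" if "\<tau> \<in> \<T>" for \<tau> x
    using K[of \<tau> x] member_le_sum[OF that, of K] K0 fin by (simp add: K'_def)
  have "K' > 0" using K0 by (simp add: K'_def add_pos_nonneg sum_nonneg)
  define \<Lambda> where "\<Lambda> = 2 * (norm (v n) + 1) * K' / \<epsilon>"
  have \<Lambda>: "\<Lambda> > 0" using \<open>K' > 0\<close> Suc.prems by (simp add: \<Lambda>_def add_nonneg_pos)
  have \<Lambda>_small: "norm (v n) * K' / \<Lambda> \<le> \<epsilon> / 2"
  proof -
    have "\<epsilon> / 2 * \<Lambda> = (norm (v n) + 1) * K'" using Suc.prems by (simp add: \<Lambda>_def)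
    then have "norm (v n) * K' \<le> \<epsilon> / 2 * \<Lambda>" using \<open>K' > 0\<close> by (simp add: algebra_simps)
    then show ?thesis using \<Lambda> by (simp only: pos_divide_le_eq)
  qed
  define l' where "l' = l(n := \<Lambda>)"
  have wave_l': "wave e l' \<tau> x k = wave e l \<tau> x k" if "k < n" for \<tau> x k
    using that by (simp add: wave_def l'_def)
  have riesz_l': "riesz (wave e l' \<tau> x) k = riesz (wave e l \<tau> x) k" if "k \<le> n" for \<tau> x k
    using that by (intro riesz_cong wave_l') auto
  have G_l': "G l' \<tau> x (Suc n) = G l \<tau> x n +
      (wave e l' \<tau> x n * riesz (wave e l \<tau> x) n) *\<^sub>R outer (v n) (e n)" for \<tau> x
    unfolding G_def by (simp add: wave_l' riesz_l')
  show ?case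
  proof (intro exI[of _ l'] ballI)
    fix \<tau> assume \<tau>: "\<tau> \<in> \<T>"
    define \<theta> where "\<theta> x = \<Lambda> * (x \<bullet> e n) + real (\<tau> n) * (pi / 2)" for x
    define s where "s x = (1 / \<Lambda>) * (sin (\<theta> x) * P \<tau> x)" for x
    define u where "u x = U \<tau> x + s x *\<^sub>R v n" for x
    have "smooth_fun (\<lambda>x. sin (\<theta> x))"
      using smooth_sin[of "\<Lambda> *\<^sub>R e n" "real (\<tau> n) * (pi / 2)"] by (simp add: \<theta>_def)
    then have "smooth_fun s"
      unfolding s_def by (intro smooth_fun.intros smP)
    then have "smooth_map u"
      unfolding u_def by (intro smooth_map_add_scaleR U \<tau>)
    moreover have "u x = 0" if "norm x \<ge> 1" for x
      using that U(2)[OF \<tau>] P0 by (simp add: u_def s_def)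
    moreover have "norm (grad u x - bump x *\<^sub>R G l' \<tau> x (Suc n)) \<le> \<epsilon>" for x
    proof -
      have "(s has_derivative (\<lambda>h. ((cos (\<theta> x) * P \<tau> x) *\<^sub>R e n + (sin (\<theta> x) / \<Lambda>) *\<^sub>R g \<tau> x) \<bullet> h)) (at x)"
        unfolding s_def \<theta>_def
        by (rule derivative_eq_intros g refl | simp)+
          (use \<Lambda> in \<open>simp add: fun_eq_iff inner_simps inner_commute field_simps\<close>)
      then have "grad u x = grad (U \<tau>) x + outer (v n) ((cos (\<theta> x) * P \<tau> x) *\<^sub>R e n + (sin (\<theta> x) / \<Lambda>) *\<^sub>R g \<tau> x)"
        unfolding u_def by (intro grad_add_scaleR U \<tau>)
      then have "grad u x = grad (U \<tau>) x + (cos (\<theta> x) * P \<tau> x) *\<^sub>R outer (v n) (e n)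
          + (sin (\<theta> x) / \<Lambda>) *\<^sub>R outer (v n) (g \<tau> x)"
        by (simp add: outer_simps)
      moreover have "wave e l' \<tau> x n = cos (\<theta> x)"
        by (simp add: wave_def l'_def \<theta>_def)
      ultimately have "grad u x - bump x *\<^sub>R G l' \<tau> x (Suc n) =
        (grad (U \<tau>) x - bump x *\<^sub>R G l \<tau> x n) + (sin (\<theta> x) / \<Lambda>) *\<^sub>R outer (v n) (g \<tau> x)"
        by (simp add: G_l' P_def scaleR_add_right mult_ac)
      also have "norm \<dots> \<le> \<epsilon> / 2 + norm ((sin (\<theta> x) / \<Lambda>) *\<^sub>R outer (v n) (g \<tau> x))"
        using U(3)[OF \<tau>, of x] by (intro norm_triangle_le) auto
      also have "norm ((sin (\<theta> x) / \<Lambda>) *\<^sub>R outer (v n) (g \<tau> x)) = \<bar>sin (\<theta> x)\<bar> * (norm (v n) * norm (g \<tau> x) / \<Lambda>)"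
        using \<Lambda> by (simp add: norm_outer)
      also have "\<dots> \<le> 1 * (norm (v n) * K' / \<Lambda>)"
        using \<Lambda> K'[OF \<tau>] \<open>K' > 0\<close> by (intro mult_mono divide_right_mono mult_left_mono) auto
      finally show ?thesis using \<Lambda>_small by linarith
    qed
    ultimately show "\<exists>u. smooth_map u \<and> (\<forall>x. norm x \<ge> 1 \<longrightarrow> u x = 0) \<and>
      (\<forall>x. norm (grad u x - bump x *\<^sub>R (\<Sum>k<Suc n. (wave e l' \<tau> x k * riesz (wave e l' \<tau> x) k) *\<^sub>R outer (v k) (e k))) \<le> \<epsilon>)"
      unfolding G_def by blast
  qed
qed

section \<open>Averaging over phases\<close>

definition phases :: "nat \<Rightarrow> (nat \<Rightarrow> nat) set" where
  "phases n = PiE {..<n} (\<lambda>_. {..<4})"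

lemma finite_phases: "finite (phases n)"
  by (simp add: phases_def finite_PiE)

lemma card_phases: "card (phases n) = 4 ^ n"
  by (simp add: phases_def card_PiE)

lemma sum_cos_phase:
  "(\<Sum>t<4. cos (\<theta> + real t * (pi / 2))) = 0"
  "(\<Sum>t<4. (cos (\<theta> + real t * (pi / 2)))\<^sup>2) = 2"
proof -
  have "cos (3 * pi / 2) = 0" "sin (3 * pi / 2) = - 1"
    using cos_add[of pi "pi/2"] sin_add[of pi "pi/2"] by (simp_all add: field_simps)
  then have c: "cos (\<theta> + 3 * pi / 2) = sin \<theta>" "cos (\<theta> + pi) = - cos \<theta>" "cos (\<theta> + pi / 2) = - sin \<theta>"
    by (simp_all add: cos_add)
  have 4: "{..<4::nat} = {0, 1, 2, 3}" by auto
  show "(\<Sum>t<4. cos (\<theta> + real t * (pi / 2))) = 0"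
    by (simp add: 4 c)
  show "(\<Sum>t<4. (cos (\<theta> + real t * (pi / 2)))\<^sup>2) = 2"
    using sin_cos_squared_add[of \<theta>] by (simp add: 4 c)
qed

text \<open>
  The phases of different waves vary independently, so the average of a product is the product of the averages.
\<close>

lemma sum_phases_prod:
  fixes h :: "nat \<Rightarrow> 'a::field_char_0" and F :: "nat \<Rightarrow> nat \<Rightarrow> 'a"
  assumes "\<And>j. j < n \<Longrightarrow> (\<Sum>t<4. F j t) = 4 * h j"
  shows "(\<Sum>\<tau>\<in>phases n. \<Prod>j<n. F j (\<tau> j)) = 4 ^ n * (\<Prod>j<n. h j)"
proof -
  have "(\<Sum>\<tau>\<in>phases n. \<Prod>j<n. F j (\<tau> j)) = (\<Prod>j<n. \<Sum>t<4. F j t)"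
    unfolding phases_def by (rule prod_sum_PiE[symmetric]) auto
  also have "\<dots> = (\<Prod>j<n. 4 * h j)" using assms by simp
  finally show ?thesis by (simp add: prod.distrib)
qed

context
  fixes \<theta> :: "nat \<Rightarrow> real" and c :: "(nat \<Rightarrow> nat) \<Rightarrow> nat \<Rightarrow> real"
  defines "c \<equiv> \<lambda>\<tau> k. cos (\<theta> k + real (\<tau> k) * (pi / 2))"
begin

lemma sum_phases_riesz: "(\<Sum>\<tau>\<in>phases n. riesz (c \<tau>) n) = 4 ^ n"
proof -
  have "(\<Sum>t<4. 1 + cos (\<theta> k + real t * (pi / 2))) = 4 * 1" for k
    unfolding sum.distrib sum_cos_phase by simp
  from sum_phases_prod[where n = n and F = "\<lambda>k t. 1 + cos (\<theta> k + real t * (pi / 2))" and h = "\<lambda>_. 1", OF this]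
  show ?thesis by (simp add: riesz_def c_def)
qed

text \<open>
  The sum is paired with the bounded Riesz product \<open>\<beta> = \<Prod>j. 1 + \<i> s j c j\<close> with \<open>s j = \<plusminus> 1 / sqrt n\<close>; the bound on \<open>\<beta>\<close>
  is \<open>(1 + 1/n) powr (n/2) \<le> 2\<close>. By independence each even \<open>k\<close> contributes
  \<open>\<i> a / 2 * (\<Prod>j<k. 1 + \<i> s j / 2)\<close> with \<open>a = 1 / sqrt n\<close>. The signs of \<open>s j\<close> alternate with the parity of \<open>j\<close>, so
  factors with \<open>j\<close> even and odd are conjugate to each other, their product is a real number that is at least \<open>1\<close>, and no
  cancellation between different \<open>k\<close> occurs. The \<open>n/2\<close> contributions add up to the order of \<open>sqrt n\<close>.
\<close>

lemma sum_phases_even_part: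
  assumes n: "n > 0"
  shows "(\<Sum>\<tau>\<in>phases n. \<bar>\<Sum>k<n. if even k then c \<tau> k * riesz (c \<tau>) k else 0\<bar>) \<ge> 4 ^ n * (sqrt n / 8)"
proof -
  define a where "a = 1 / sqrt n"
  have a: "a > 0" "a\<^sup>2 = 1 / n" using n by (simp_all add: a_def power_divide)
  define s :: "nat \<Rightarrow> real" where "s j = (if even j then a else - a)" for j
  have s2: "(s j)\<^sup>2 = 1 / n" for j using a by (simp add: s_def)
  define \<beta> where "\<beta> \<tau> = (\<Prod>j<n. 1 + \<i> * complex_of_real (s j * c \<tau> j))" for \<tau>
  define S where "S \<tau> = (\<Sum>k<n. if even k then c \<tau> k * riesz (c \<tau>) k else 0)" for \<tau>
  have \<beta>: "cmod (\<beta> \<tau>) \<le> 2" for \<tau>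
  proof -
    have "(cmod (\<beta> \<tau>))\<^sup>2 = (\<Prod>j<n. (cmod (1 + \<i> * complex_of_real (s j * c \<tau> j)))\<^sup>2)"
      unfolding \<beta>_def prod_norm[symmetric] prod_power_distrib ..
    also have "\<dots> = (\<Prod>j<n. 1 + (s j * c \<tau> j)\<^sup>2)"
      by (simp add: cmod_power2)
    also have "\<dots> \<le> (\<Prod>j<n. exp (1 / n))"
    proof (intro prod_mono conjI)
      fix j
      have "(c \<tau> j)\<^sup>2 \<le> 1" by (simp add: c_def cos_squared_eq)
      then have "(s j * c \<tau> j)\<^sup>2 \<le> 1 / n"
        by (simp add: power_mult_distrib s2 divide_le_cancel divide_right_mono)
      then show "1 + (s j * c \<tau> j)\<^sup>2 \<le> exp (1 / n)"
        using exp_ge_add_one_self[of "1 / n"] by linarith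
    qed auto
    also have "\<dots> = exp 1" using n by (simp add: exp_of_nat_mult[symmetric])
    also have "\<dots> \<le> 2\<^sup>2" using exp_le by simp
    finally show ?thesis by (rule power2_le_imp_le) simp
  qed
  \<comment> \<open>the factors with \<open>j < k\<close> (case \<open>r = 1\<close>) and \<open>j = k\<close> (case \<open>r = 0\<close>) of the pairing with the \<open>k\<close>-th summand\<close>
  have pair: "(\<Sum>t<4. (1 + \<i> * complex_of_real (s j * cos (\<theta> j + real t * (pi / 2)))) * complex_of_real (r + cos (\<theta> j + real t * (pi / 2))))
      = 4 * (r + \<i> * complex_of_real (s j / 2))" for j and r :: real
  proof -
    let ?c = "\<lambda>t. cos (\<theta> j + real t * (pi / 2))"
    have "(1 + \<i> * complex_of_real (s j * ?c t)) * complex_of_real (r + ?c t)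
      = of_real r + of_real (?c t) + \<i> * of_real (s j * r) * of_real (?c t) + \<i> * of_real (s j) * of_real ((?c t)\<^sup>2)" for t
      by (simp add: algebra_simps power2_eq_square)
    then have "(\<Sum>t<4. (1 + \<i> * complex_of_real (s j * ?c t)) * complex_of_real (r + ?c t))
      = 4 * of_real r + of_real (\<Sum>t<4. ?c t) + \<i> * of_real (s j * r) * of_real (\<Sum>t<4. ?c t)
        + \<i> * of_real (s j) * of_real (\<Sum>t<4. (?c t)\<^sup>2)"
      by (simp only: sum.distrib of_real_sum sum_distrib_left) simp
    then show ?thesis unfolding sum_cos_phase by simp
  qed
  \<comment> \<open>the factors with \<open>j > k\<close>, where only \<open>\<beta>\<close> depends on the phase\<close>
  have single: "(\<Sum>t<4. 1 + \<i> * complex_of_real (s j * cos (\<theta> j + real t * (pi / 2)))) = 4" for j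
  proof -
    have "(\<Sum>t<4. 1 + \<i> * complex_of_real (s j * cos (\<theta> j + real t * (pi / 2))))
      = 4 + \<i> * of_real (s j) * of_real (\<Sum>t<4. cos (\<theta> j + real t * (pi / 2)))"
      by (simp only: sum.distrib of_real_sum sum_distrib_left of_real_mult mult.assoc) simp
    then show ?thesis unfolding sum_cos_phase by simp
  qed
  have prod_conj: "(\<Prod>j<2 * m. 1 + \<i> * complex_of_real (s j / 2)) = complex_of_real ((1 + a\<^sup>2 / 4) ^ m)" for m
  proof (induction m)
    case (Suc m)
    have "(1 + \<i> * complex_of_real (a / 2)) * (1 + \<i> * complex_of_real (- a / 2)) = complex_of_real (1 + a\<^sup>2 / 4)"
      by (simp add: algebra_simps power2_eq_square)
    with Suc show ?case by (simp add: s_def mult_ac)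
  qed simp
  have corr: "(\<Sum>\<tau>\<in>phases n. \<beta> \<tau> * of_real (c \<tau> k * riesz (c \<tau>) k)) = 4 ^ n * (\<i> * of_real (a / 2 * (1 + a\<^sup>2 / 4) ^ (k div 2)))"
    if k: "k < n" "even k" for k
  proof -
    define R :: "nat \<Rightarrow> real \<Rightarrow> complex" where "R j y = of_real (if j < k then 1 + y else if j = k then y else 1)" for j y
    define F where "F j t = (1 + \<i> * complex_of_real (s j * cos (\<theta> j + real t * (pi / 2)))) * R j (cos (\<theta> j + real t * (pi / 2)))" for j t
    define h where "h j = (if j < k then 1 + \<i> * complex_of_real (s j / 2) else if j = k then \<i> * complex_of_real (a / 2) else 1)" for j
    have trunc: "(\<Prod>j<n. f j) = (\<Prod>j<k. f j) * f k" if "\<And>j. j > k \<Longrightarrow> f j = 1" for f :: "nat \<Rightarrow> complex"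
    proof -
      have "(\<Prod>j<n. f j) = (\<Prod>j<Suc k. f j)"
        using k that by (intro prod.mono_neutral_right) auto
      then show ?thesis by simp
    qed
    have "of_real (c \<tau> k * riesz (c \<tau>) k) = (\<Prod>j<n. R j (c \<tau> j))" for \<tau>
      by (subst trunc) (auto simp: R_def riesz_def mult.commute)
    then have "(\<Sum>\<tau>\<in>phases n. \<beta> \<tau> * of_real (c \<tau> k * riesz (c \<tau>) k)) = (\<Sum>\<tau>\<in>phases n. \<Prod>j<n. F j (\<tau> j))"
      by (simp add: \<beta>_def F_def c_def prod.distrib)
    also have "\<dots> = 4 ^ n * (\<Prod>j<n. h j)"
    proof (rule sum_phases_prod)
      fix j
      consider "j < k" | "j = k" | "j > k" by linarith
      then show "(\<Sum>t<4. F j t) = 4 * h j"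
      proof cases
        case 1 then show ?thesis using pair[of j 1] by (simp add: F_def h_def R_def)
      next
        case 2 then show ?thesis using pair[of j 0] k by (simp add: F_def h_def R_def s_def)
      next
        case 3 then show ?thesis using single[of j] by (simp add: F_def h_def R_def)
      qed
    qed
    also have "(\<Prod>j<n. h j) = (\<Prod>j<k. 1 + \<i> * complex_of_real (s j / 2)) * (\<i> * of_real (a / 2))"
      by (subst trunc) (auto simp: h_def)
    also have "(\<Prod>j<k. 1 + \<i> * complex_of_real (s j / 2)) = of_real ((1 + a\<^sup>2 / 4) ^ (k div 2))"
      using prod_conj[of "k div 2"] k by simp
    finally show ?thesis by (simp add: mult_ac)
  qed
  have "(\<Sum>\<tau>\<in>phases n. \<beta> \<tau> * of_real (S \<tau>))
    = (\<Sum>k<n. \<Sum>\<tau>\<in>phases n. \<beta> \<tau> * of_real (if even k then c \<tau> k * riesz (c \<tau>) k else 0))"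
    unfolding S_def of_real_sum sum_distrib_left by (rule sum.swap)
  also have "\<dots> = (\<Sum>k<n. 4 ^ n * (\<i> * of_real (if even k then a / 2 * (1 + a\<^sup>2 / 4) ^ (k div 2) else 0)))"
    using corr by (intro sum.cong) auto
  also have "\<dots> = 4 ^ n * (\<i> * of_real (\<Sum>k<n. if even k then a / 2 * (1 + a\<^sup>2 / 4) ^ (k div 2) else 0))"
    by (simp only: sum_distrib_left of_real_sum)
  finally have eq: "cmod (\<Sum>\<tau>\<in>phases n. \<beta> \<tau> * of_real (S \<tau>))
    = 4 ^ n * \<bar>\<Sum>k<n. if even k then a / 2 * (1 + a\<^sup>2 / 4) ^ (k div 2) else 0\<bar>"
    by (simp add: norm_mult norm_power del: of_real_sum)
  have "a * n / 4 \<le> (\<Sum>k<n. if even k then a / 2 else 0)"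
  proof -
    have "real m / 2 \<le> (\<Sum>k<m. if even k then 1 else 0) \<and> (odd m \<longrightarrow> (real m + 1) / 2 \<le> (\<Sum>k<m. if even k then 1 else 0))" for m :: nat
      by (induction m) auto
    then have "a / 2 * (real n / 2) \<le> a / 2 * (\<Sum>k<n. if even k then 1 else 0)"
      using a by (intro mult_left_mono) auto
    then show ?thesis by (simp add: sum_distrib_left if_distrib cong: if_cong)
  qed
  also have "\<dots> \<le> (\<Sum>k<n. if even k then a / 2 * (1 + a\<^sup>2 / 4) ^ (k div 2) else 0)"
    using a by (intro sum_mono) (auto intro!: one_le_power)
  also have "\<dots> \<le> \<bar>\<dots>\<bar>" by simp
  finally have "4 ^ n * (a * n / 4) \<le> cmod (\<Sum>\<tau>\<in>phases n. \<beta> \<tau> * of_real (S \<tau>))"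
    unfolding eq by (intro mult_left_mono) auto
  also have "\<dots> \<le> (\<Sum>\<tau>\<in>phases n. cmod (\<beta> \<tau>) * \<bar>S \<tau>\<bar>)"
    by (rule order_trans[OF norm_sum]) (simp add: norm_mult)
  also have "\<dots> \<le> (\<Sum>\<tau>\<in>phases n. 2 * \<bar>S \<tau>\<bar>)"
    using \<beta> by (intro sum_mono mult_right_mono) auto
  finally have "4 ^ n * (a * n / 8) \<le> (\<Sum>\<tau>\<in>phases n. \<bar>S \<tau>\<bar>)"
    by (simp add: sum_distrib_left[symmetric])
  moreover have "a * n = sqrt n"
    by (simp add: a_def real_div_sqrt)
  ultimately show ?thesis by (simp add: S_def)
qed

end

section \<open>Failure of the L1 estimate\<close>

lemma integrable_supported_in_ball:
  fixes f :: "real^'d \<Rightarrow> real"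
  assumes "continuous_on UNIV f" "\<And>x. norm x > 1 \<Longrightarrow> f x = 0"
  shows "integrable lborel f"
proof -
  have "integrable lborel (\<lambda>x. indicator (cball 0 1) x *\<^sub>R f x)"
    using assms(1) continuous_on_subset by (intro borel_integrable_compact) auto
  also have "(\<lambda>x. indicator (cball 0 1) x *\<^sub>R f x) = f"
    using assms(2) by (auto simp: fun_eq_iff indicator_def not_le)
  finally show ?thesis .
qed

lemma integrable_bump: "integrable lborel (bump :: real^'d \<Rightarrow> real)"
  by (intro integrable_supported_in_ball smooth_fun_continuous smooth_bump) (auto simp: bump_eq_0)

lemma integral_bump_pos: "0 < (LINT x|lborel. bump (x :: real^'d))"
proof -
  let ?B = "cball 0 (1/2) :: (real^'d) set"
  have "0 < exp (-2) * measure lborel ?B"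
    using content_cball_pos[of "1/2" "0 :: real^'d"] by simp
  also have "\<dots> = (LINT x|lborel. exp (-2) * indicator ?B x)"
    by simp
  also have "\<dots> \<le> (LINT x|lborel. bump (x :: real^'d))"
  proof (rule integral_mono)
    show "integrable lborel (\<lambda>x. exp (-2) * indicator ?B x :: real)"
      by (auto intro!: integrable_mult_right integrable_real_indicator emeasure_lborel_cball_finite)
    show "exp (- 2) * indicator ?B x \<le> bump x" for x
    proof (cases "x \<in> ?B")
      case True
      then have "(norm x)\<^sup>2 \<le> (1/2)\<^sup>2" by (intro power_mono) auto
      then have x: "1 - x \<bullet> x \<ge> 1/2" by (simp add: dot_square_norm power2_eq_square)
      then have "inverse (1 - x \<bullet> x) \<le> inverse (1/2)" by (intro le_imp_inverse_le) auto
      then show ?thesis using True x by (simp add: bump_def flat_def)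
    qed (simp add: bump_nonneg)
  qed (rule integrable_bump)
  finally show ?thesis .
qed

text \<open>
  Write \<open>A = X + Y\<close> with \<open>X\<close> and \<open>Y\<close> of rank at most one, and let even waves oscillate along \<open>X\<close> and odd waves
  along \<open>- Y\<close>. The limit gradient is \<open>S A - (P - 1) Y\<close>, where \<open>P\<close> is the whole Riesz product and \<open>S\<close> the even part of its
  telescoping sum. As \<open>T A = 0\<close>, the operator only sees \<open>(P - 1) T X\<close>, whose average is bounded, whereas the average
  of \<open>\<bar>S\<bar>\<close> is at least of order \<open>sqrt n\<close>. The number \<open>n\<close> of waves is chosen first, the accuracy \<open>\<epsilon>\<close> of the approximation after
  it. No single phase needs to be good: the assumed estimate is summed over all of them.
\<close>

lemma no_L1_estimate:
  fixes T :: "real^'d^'m \<Rightarrow> real^'k"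
  assumes T: "linear T" and A: "A \<noteq> 0" "rank A \<le> 2" "T A = 0"
  shows "\<nexists>C::real. \<forall>u. test_function u \<longrightarrow> L1_norm (grad u) \<le> C * L1_norm (diff_op T u)"
proof
  assume "\<exists>C::real. \<forall>u. test_function u \<longrightarrow> L1_norm (grad u) \<le> C * L1_norm (diff_op T u)"
  then obtain C0 where C0: "\<And>u. test_function u \<Longrightarrow> L1_norm (grad u) \<le> C0 * L1_norm (diff_op T u)"
    by blast
  define C where "C = max C0 0"
  have "C \<ge> 0" by (simp add: C_def)
  have C: "L1_norm (grad u) \<le> C * L1_norm (diff_op T u)" if "test_function u" for u
  proof -
    have "L1_norm (diff_op T u) \<ge> 0" by (simp add: L1_norm_def)
    then have "C0 * L1_norm (diff_op T u) \<le> C * L1_norm (diff_op T u)"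
      by (intro mult_right_mono) (simp_all add: C_def)
    then show ?thesis using C0[OF that] by linarith
  qed
  obtain K where K: "K > 0" "\<And>B. norm (T B) \<le> K * norm B"
    using linear_bounded_pos[OF T] by blast
  obtain a b a' b' where A_eq: "A = outer a b + outer a' b'"
    using rank_le_2_imp_sum_outer A(2) by blast
  define X where "X = outer a b"
  define Y where "Y = outer a' b'"
  have XY: "A = X + Y" using A_eq by (simp add: X_def Y_def)
  define v where "v k = (if even k then a else - a')" for k :: nat
  define e where "e k = (if even k then b else b')" for k :: nat
  have ve: "outer (v k) (e k) = (if even k then A else 0) - Y" for k
    by (simp add: v_def e_def XY X_def Y_def outer_simps)
  have TY: "T Y = - T X" using A(3) T by (simp add: XY linear_add eq_neg_iff_add_eq_0 add.commute)
  have nA: "norm A > 0" using A(1) by simp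
  obtain n :: nat where n: "n > 0" "norm A * (sqrt n / 8) - 2 * (norm Y + C * norm (T X)) \<ge> 1"
  proof -
    define r where "r = 8 * (1 + 2 * (norm Y + C * norm (T X))) / norm A"
    obtain n :: nat where "real n > max 1 (r\<^sup>2)" using reals_Archimedean2 by blast
    then have "r \<le> sqrt n" "n > 0" by (auto intro: real_le_rsqrt)
    then have "8 * (1 + 2 * (norm Y + C * norm (T X))) \<le> sqrt n * norm A"
      using nA by (simp only: r_def pos_divide_le_eq)
    then show thesis using \<open>n > 0\<close> by (intro that[of n]) (simp_all add: algebra_simps)
  qed
  define J where "J = (LINT x|lborel. bump (x :: real^'d))"
  define V where "V = measure lborel (cball 0 1 :: (real^'d) set)"
  have J: "J > 0" unfolding J_def by (rule integral_bump_pos)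
  have "V \<ge> 0" by (simp add: V_def)
  \<comment> \<open>the approximation costs at most \<open>\<epsilon> * (1 + C * K)\<close> at each point of the unit ball, and this integrates to less than \<open>J\<close>\<close>
  define \<epsilon> where "\<epsilon> = J / ((1 + C * K) * (V + 1))"
  have CK: "1 + C * K > 0" using \<open>C \<ge> 0\<close> K by (simp add: add_pos_nonneg)
  have "\<epsilon> > 0" using J CK \<open>V \<ge> 0\<close> by (simp add: \<epsilon>_def)
  define \<delta> where "\<delta> = \<epsilon> * (1 + C * K)"
  have "\<delta> * (V + 1) = J" using CK \<open>V \<ge> 0\<close> by (simp add: \<delta>_def \<epsilon>_def)
  moreover have "\<delta> > 0" using \<open>\<epsilon> > 0\<close> CK by (simp add: \<delta>_def)
  ultimately have \<delta>: "\<delta> * V < J" by (simp add: distrib_left)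
  define c where "c l \<tau> x = wave e l \<tau> x" for l \<tau> and x :: "real^'d"
  define G where "G l \<tau> x = (\<Sum>k<n. (c l \<tau> x k * riesz (c l \<tau> x) k) *\<^sub>R outer (v k) (e k))" for l \<tau> x
  from oscillating_maps[where v = v and e = e and n = n, OF finite_phases[of n] \<open>\<epsilon> > 0\<close>, folded c_def, folded G_def]
  obtain l where "\<forall>\<tau>\<in>phases n. \<exists>u. smooth_map u \<and> (\<forall>x. norm x \<ge> 1 \<longrightarrow> u x = 0) \<and>
      (\<forall>x. norm (grad u x - bump x *\<^sub>R G l \<tau> x) \<le> \<epsilon>)" by blast
  then obtain u where u: "\<And>\<tau>. \<tau> \<in> phases n \<Longrightarrow> smooth_map (u \<tau>)"
    "\<And>\<tau> x. \<tau> \<in> phases n \<Longrightarrow> norm x \<ge> 1 \<Longrightarrow> u \<tau> x = 0"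
    "\<And>\<tau> x. \<tau> \<in> phases n \<Longrightarrow> norm (grad (u \<tau>) x - bump x *\<^sub>R G l \<tau> x) \<le> \<epsilon>" by metis
  define F where "F \<tau> x = norm (grad (u \<tau>) x) - C * norm (T (grad (u \<tau>) x))" for \<tau> x
  have F0: "F \<tau> x = 0" if "\<tau> \<in> phases n" "norm x > 1" for \<tau> x
    using grad_eq_0_outside[of "u \<tau>" x] u(2) that T by (simp add: F_def linear_0)
  have contG: "continuous_on UNIV (\<lambda>x. grad (u \<tau>) x)" if "\<tau> \<in> phases n" for \<tau>
    using continuous_on_grad[OF u(1)[OF that]] by simp
  have contT: "continuous_on UNIV (\<lambda>x. T (grad (u \<tau>) x))" if "\<tau> \<in> phases n" for \<tau>
    using contG[OF that] T linear_conv_bounded_linear bounded_linear.continuous_on by blast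
  have g0: "grad (u \<tau>) x = 0" if "\<tau> \<in> phases n" "norm x > 1" for \<tau> x
    using grad_eq_0_outside[of "u \<tau>" x] u(2) that by simp
  have int1: "integrable lborel (\<lambda>x. norm (grad (u \<tau>) x))" if "\<tau> \<in> phases n" for \<tau>
    using contG[OF that] g0[OF that] by (intro integrable_supported_in_ball continuous_intros) auto
  have int2: "integrable lborel (\<lambda>x. norm (T (grad (u \<tau>) x)))" if "\<tau> \<in> phases n" for \<tau>
    using contT[OF that] g0[OF that] T by (intro integrable_supported_in_ball continuous_intros) (auto simp: linear_0)
  have intF: "integrable lborel (F \<tau>)" if "\<tau> \<in> phases n" for \<tau>
    unfolding F_def using int1[OF that] int2[OF that] by auto
  have "(LINT x|lborel. F \<tau> x) \<le> 0" if "\<tau> \<in> phases n" for \<tau>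
  proof -
    have "test_function (u \<tau>)" using u that by (intro smooth_map_test_function) auto
    from C[OF this] show ?thesis
      unfolding F_def L1_norm_def diff_op_def
      using int1[OF that] int2[OF that] by simp
  qed
  then have "(\<Sum>\<tau>\<in>phases n. LINT x|lborel. F \<tau> x) \<le> 0" by (intro sum_nonpos) auto
  then have "(LINT x|lborel. (\<Sum>\<tau>\<in>phases n. F \<tau> x)) \<le> 0"
    using intF by (simp add: Bochner_Integration.integral_sum)
  moreover have "4 ^ n * (J - \<delta> * V) \<le> (LINT x|lborel. (\<Sum>\<tau>\<in>phases n. F \<tau> x))"
  proof -
    have intI: "integrable lborel (\<lambda>x :: real^'d. \<delta> * indicator (cball 0 1) x)"
      by (intro integrable_mult_right integrable_real_indicator)
        (use emeasure_lborel_cball_finite[of "0 :: real^'d" 1] in auto)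
    have intB: "integrable lborel (\<lambda>x :: real^'d. 4 ^ n * (bump x - \<delta> * indicator (cball 0 1) x))"
      by (intro integrable_mult_right[OF Bochner_Integration.integrable_diff] integrable_bump intI)
    have "4 ^ n * (J - \<delta> * V) = (LINT x|lborel. 4 ^ n * (bump (x :: real^'d) - \<delta> * indicator (cball 0 1) x))"
      unfolding J_def V_def
      by (simp add: Bochner_Integration.integral_diff[OF integrable_bump intI])
    also have "\<dots> \<le> (LINT x|lborel. (\<Sum>\<tau>\<in>phases n. F \<tau> x))"
    proof (rule integral_mono[OF intB])
      show "integrable lborel (\<lambda>x. \<Sum>\<tau>\<in>phases n. F \<tau> x)" using intF by auto
      fix x :: "real^'d"
      show "4 ^ n * (bump x - \<delta> * indicator (cball 0 1) x) \<le> (\<Sum>\<tau>\<in>phases n. F \<tau> x)"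
      proof (cases "norm x \<le> 1")
        case False
        then show ?thesis using F0 by (simp add: bump_eq_0)
      next
        case True
        define P where "P \<tau> = riesz (c l \<tau> x) n" for \<tau>
        define S where "S \<tau> = (\<Sum>k<n. if even k then c l \<tau> x k * riesz (c l \<tau> x) k else 0)" for \<tau>
        have G_eq: "G l \<tau> x = S \<tau> *\<^sub>R A - (P \<tau> - 1) *\<^sub>R Y" for \<tau>
        proof -
          have "G l \<tau> x = (\<Sum>k<n. (if even k then c l \<tau> x k * riesz (c l \<tau> x) k else 0) *\<^sub>R A
              - (c l \<tau> x k * riesz (c l \<tau> x) k) *\<^sub>R Y)"
            unfolding G_def ve by (intro sum.cong) (auto simp: scaleR_diff_right)
          then show ?thesis
            by (simp add: sum_subtractf S_def P_def riesz_telescope flip: scaleR_left.sum)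
        qed
        have P0: "P \<tau> \<ge> 0" for \<tau>
        proof -
          have "1 + c l \<tau> x j \<ge> 0" for j
            using cos_ge_minus_one[of "l j * (x \<bullet> e j) + real (\<tau> j) * (pi / 2)"]
            unfolding c_def wave_def by linarith
          then show ?thesis unfolding P_def riesz_def by (intro prod_nonneg) auto
        qed
        have lower: "bump x * (\<bar>S \<tau>\<bar> * norm A - (P \<tau> + 1) * (norm Y + C * norm (T X))) - \<delta> \<le> F \<tau> x"
          if \<tau>: "\<tau> \<in> phases n" for \<tau>
        proof -
          define E where "E = grad (u \<tau>) x - bump x *\<^sub>R G l \<tau> x"
          have E: "norm E \<le> \<epsilon>" using u(3)[OF \<tau>] by (simp add: E_def)
          have gr: "grad (u \<tau>) x = bump x *\<^sub>R G l \<tau> x + E" by (simp add: E_def)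
          have P1: "\<bar>P \<tau> - 1\<bar> \<le> P \<tau> + 1" using P0[of \<tau>] by linarith
          have "norm (S \<tau> *\<^sub>R A) - norm ((P \<tau> - 1) *\<^sub>R Y) \<le> norm (G l \<tau> x)"
            unfolding G_eq by (rule norm_triangle_ineq2)
          moreover have "\<bar>P \<tau> - 1\<bar> * norm Y \<le> (P \<tau> + 1) * norm Y"
            using P1 by (intro mult_right_mono) auto
          ultimately have "\<bar>S \<tau>\<bar> * norm A - (P \<tau> + 1) * norm Y \<le> norm (G l \<tau> x)"
            by simp
          then have "bump x * (\<bar>S \<tau>\<bar> * norm A - (P \<tau> + 1) * norm Y) \<le> bump x * norm (G l \<tau> x)"
            by (intro mult_left_mono bump_nonneg)
          also have "\<dots> - norm E \<le> norm (grad (u \<tau>) x)"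
            unfolding gr using norm_diff_ineq[of "bump x *\<^sub>R G l \<tau> x" E] bump_nonneg[of x] by simp
          finally have 1: "bump x * (\<bar>S \<tau>\<bar> * norm A - (P \<tau> + 1) * norm Y) - \<epsilon> \<le> norm (grad (u \<tau>) x)"
            using E by simp
          have "T (G l \<tau> x) = (P \<tau> - 1) *\<^sub>R T X"
            using T A(3) TY by (simp add: G_eq linear_diff linear_cmul)
          then have "T (grad (u \<tau>) x) = bump x *\<^sub>R ((P \<tau> - 1) *\<^sub>R T X) + T E"
            using T by (simp add: gr linear_add linear_cmul)
          then have "norm (T (grad (u \<tau>) x)) \<le> bump x * (\<bar>P \<tau> - 1\<bar> * norm (T X)) + norm (T E)"
            using norm_triangle_ineq[of "bump x *\<^sub>R ((P \<tau> - 1) *\<^sub>R T X)" "T E"] bump_nonneg[of x]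
            by (simp add: abs_mult)
          also have "\<dots> \<le> bump x * ((P \<tau> + 1) * norm (T X)) + K * \<epsilon>"
          proof (intro add_mono mult_left_mono mult_right_mono P1 bump_nonneg)
            show "norm (T E) \<le> K * \<epsilon>"
              using K(2)[of E] mult_left_mono[OF E, of K] K(1) by linarith
          qed simp
          finally have "C * norm (T (grad (u \<tau>) x)) \<le> C * (bump x * ((P \<tau> + 1) * norm (T X)) + K * \<epsilon>)"
            using \<open>C \<ge> 0\<close> by (rule mult_left_mono)
          with 1 show ?thesis by (simp add: F_def \<delta>_def algebra_simps)
        qed
        have sumP: "(\<Sum>\<tau>\<in>phases n. P \<tau>) = 4 ^ n"
          unfolding P_def c_def wave_def by (rule sum_phases_riesz)
        have sumS: "(\<Sum>\<tau>\<in>phases n. \<bar>S \<tau>\<bar>) \<ge> 4 ^ n * (sqrt n / 8)"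
          unfolding S_def c_def wave_def by (rule sum_phases_even_part[OF n(1)])
        let ?q = "norm Y + C * norm (T X)"
        have "4 ^ n * (bump x - \<delta>) \<le> 4 ^ n * (bump x * (norm A * (sqrt n / 8) - 2 * ?q) - \<delta>)"
          using n(2) bump_nonneg[of x] by (simp add: mult_le_cancel_left1)
        also have "\<dots> = bump x * (4 ^ n * (sqrt n / 8) * norm A - (4 ^ n + 4 ^ n) * ?q) - 4 ^ n * \<delta>"
          by (simp add: algebra_simps)
        also have "\<dots> \<le> bump x * ((\<Sum>\<tau>\<in>phases n. \<bar>S \<tau>\<bar>) * norm A - (4 ^ n + 4 ^ n) * ?q) - 4 ^ n * \<delta>"
          using sumS by (intro diff_mono mult_left_mono mult_right_mono bump_nonneg) auto
        also have "\<dots> = (\<Sum>\<tau>\<in>phases n. bump x * (\<bar>S \<tau>\<bar> * norm A - (P \<tau> + 1) * ?q) - \<delta>)"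
        proof -
          have "4 ^ n + 4 ^ n = (\<Sum>\<tau>\<in>phases n. P \<tau> + 1)"
            by (simp add: sum.distrib sumP card_phases)
          then show ?thesis
            by (simp only: sum_subtractf sum_distrib_left[symmetric] sum_distrib_right[symmetric] sum_constant card_phases)
              simp
        qed
        also have "\<dots> \<le> (\<Sum>\<tau>\<in>phases n. F \<tau> x)" by (intro sum_mono lower)
        finally show ?thesis using True by simp
      qed
    qed
    finally show ?thesis .
  qed
  moreover have "4 ^ n * (J - \<delta> * V) > 0" using \<delta> by simp
  ultimately show False by linarith
qed

section \<open>Operators whose kernel contains a matrix of rank at most two\<close>

theorem theorem6p2:
  fixes T :: "real^'d^'m \<Rightarrow> real^'k"
  assumes "linear T"
    and "\<exists>A. A \<noteq> 0 \<and> rank A \<le> 2 \<and> T A = 0"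
  shows "(\<nexists>C::real. \<forall>u. test_function u \<longrightarrow> L1_norm (grad u) \<le> C * L1_norm (diff_op T u))
    \<and> (\<forall>p. 1 < p \<and> p \<le> 2 \<longrightarrow> (C_min T p < \<infinity> \<longleftrightarrow> \<not> (\<exists>A. rank A = 1 \<and> T A = 0)))
    \<and> (\<forall>p>2. C_min T p < \<infinity> \<longrightarrow> \<not> (\<exists>A. rank A = 1 \<and> T A = 0))
    \<and> (\<exists>c>0. (\<forall>\<^sub>F p in at_right 1. ereal (c * (pstar p - 1)) \<le> C_min T p)
          \<and> (\<forall>\<^sub>F p in at_top. ereal (c * (pstar p - 1)) \<le> C_min T p))"
proof -
  obtain A where A: "A \<noteq> 0" "rank A \<le> 2" "T A = 0" using assms(2) by blast
  note T = \<open>linear T\<close>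
  have inf: "C_min T p = \<infinity>" if "p > 2" for p
    using C_min_infinite_p_gt_2[OF T that] A by blast
  obtain c where c: "c > 0" "\<forall>\<^sub>F p in at_right 1. ereal (c * (pstar p - 1)) \<le> C_min T p"
    using C_min_blow_up_at_1[OF T A] by blast
  have "\<forall>\<^sub>F p in at_top. ereal (c * (pstar p - 1)) \<le> C_min T p"
    using eventually_gt_at_top[of 2] by eventually_elim (simp add: inf)
  moreover have "C_min T p < \<infinity> \<longleftrightarrow> \<not> (\<exists>A. rank A = 1 \<and> T A = 0)" if "1 < p" "p \<le> 2" for p
    using C_min_finite[OF T that] C_min_infinite_rank_one[OF T that(1)] by fastforce
  ultimately show ?thesis
    using no_L1_estimate[OF T A] inf c by (intro conjI) auto
qed

end
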